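(* The dynamical theories $\mathcal{P}_{3,dir}$, $\mathcal{P}_{3,dyn1}$, $\mathcal{P}_{3,sim1}$ and $\mathcal{P}_{3,sim2}$ collapse simultaneously. The dynamical theories $\mathcal{P}_{3,dyn1}$ and $\mathcal{P}_{3,sim1}$ prove the same facts.
   Context: Dynamical theories. A dynamical theory consists of a language (constants, function symbols, predicate symbols) and a set of axioms which are rules of the form $H(\mathbf{x})\vdash A_1(\mathbf{x})\ \mathrm{or}\ \cdots\ \mathrm{or}\ A_k(\mathbf{x})$, where $H$ and the $A_i$ are finite lists (read as conjunctions, possibly empty for $H$) of atomic formulas in the variables $\mathbf{x}$ (the general notion also allows existential quantifiers on the right, but none occur in the theories below). There is a logical constant $\mathsf{False}$, with the axioms $\mathsf{False}\vdash Q(\mathbf{x})$ for every predicate $Q$. A dynamical algebraic structure $S=(\mathcal{T},(G\vert R))$ of type $\mathcal{T}$ is given by a set $G$ of generators (new constants) and a set $R$ of relations (closed atomic formulas built on the language and $G$). A fact of $S$ is a closed atomic formula built on the language and $G$. A dynamical evaluation of $S$ is a finite tree: at the root the facts in $R$ are valid; at any node one may apply an axiom by substituting for $\mathbf{x}$ closed terms $\mathbf{t}$ such that the facts $H(\mathbf{t})$ are valid at that node, creating $k$ branches, the facts $A_i(\mathbf{t})$ becoming valid in the $i$-th branch; validity is inherited along branches. A fact is true (or proved) in $S$ if there is a dynamical evaluation such that it is valid at all leaves. A branch is dead if $\mathsf{False}$ is valid in it; $S$ collapses if some dynamical evaluation has all its branches dead. Two theories on the same language collapse simultaneously if for every presentation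 $(G\vert R)$ the structure of the first type with that presentation collapses if and only if the one of the second type does. They prove the same facts if for every presentation $(G\vert R)$ the two corresponding structures have the same true facts. Language. The language is that of commutative rings with the unary predicates $x=0$, $\mathrm{Ide}_i(x)$, $\mathrm{Ndz}_i(x)$ for $i=1,2,3$. Here $x=y$ abbreviates $x-y=0$, and terms are identified with their normal form as polynomials with integer coefficients; thus closed terms over $G$ are elements of the polynomial ring $\mathbb{Z}[G]$. Axioms. Each axiom with index $i$ is taken for $i=1,2,3$, except that axioms involving $i+1$ are taken for $i=1,2$. $(\mathrm{A}_0)$: $\vdash 0=0$; $(x=0,\,y=0)\vdash x+y=0$; $x=0\vdash ax=0$; $1=0\vdash\mathsf{False}$. $(\mathrm{A}_1)$: $x=0\vdash \mathrm{Ide}_i(x)$; $(\mathrm{Ide}_i(x),\mathrm{Ide}_i(y))\vdash \mathrm{Ide}_i(x+y)$; $\mathrm{Ide}_i(x)\vdash \mathrm{Ide}_i(ax)$; $\mathrm{Ide}_i(x)\vdash \mathrm{Ide}_{i+1}(x)$; $\mathrm{Ide}_i(1)\vdash\mathsf{False}$; $\vdash \mathrm{Ndz}_i(1)$; $(\mathrm{Ndz}_i(x),\mathrm{Ndz}_i(y))\vdash \mathrm{Ndz}_i(xy)$; $(x=0,\mathrm{Ndz}_i(y))\vdash \mathrm{Ndz}_i(x+y)$. $(\mathrm{A}_2)$: $\mathrm{Ndz}_i(0)\vdash\mathsf{False}$; $(\mathrm{Ide}_i(x),\mathrm{Ndz}_i(y))\vdash \mathrm{Ndz}_i(x+y)$;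 $\mathrm{Ndz}_{i+1}(x)\vdash \mathrm{Ndz}_i(x)$. $(\mathrm{A}_3)$: $(\mathrm{Ide}_i(xy),\mathrm{Ndz}_i(y))\vdash \mathrm{Ide}_i(x)$. $(\mathrm{A}_4)$: $\mathrm{Ndz}_i(xy)\vdash(\mathrm{Ndz}_i(x),\mathrm{Ndz}_i(y))$; $\mathrm{Ide}_i(x^2)\vdash \mathrm{Ide}_i(x)$. $(\mathrm{A}_5)$: $\vdash \mathrm{Ide}_i(x)\ \mathrm{or}\ \mathrm{Ndz}_i(x)$. Theories. $\mathcal{P}_{3,dir}$ has the axioms $\mathrm{A}_0,\mathrm{A}_1,\mathrm{A}_2$; $\mathcal{P}_{3,dyn1}$ has $\mathrm{A}_0,\mathrm{A}_1,\mathrm{A}_2,\mathrm{A}_5$; $\mathcal{P}_{3,sim1}$ has $\mathrm{A}_0,\mathrm{A}_1,\mathrm{A}_2,\mathrm{A}_3,\mathrm{A}_4$; $\mathcal{P}_{3,sim2}$ has $\mathrm{A}_0,\mathrm{A}_1,\mathrm{A}_3$. *)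

theory Defs
  imports Main "HOL-Library.Poly_Mapping"
begin

section \<open>Terms\<close>

text \<open>
  Terms of the language of commutative rings are identified with their normal form: a polynomial
  with integer coefficients, i.e. a finitely supported map from monomials (finitely supported
  exponent vectors) to coefficients. The same type serves for the terms of the axioms, whose
  indeterminates are the variables (type \<^typ>\<open>nat\<close>), and for closed terms, whose indeterminates
  are the generators (type \<open>'g\<close>).
\<close>

type_synonym 'v ring_term = "('v \<Rightarrow>\<^sub>0 nat) \<Rightarrow>\<^sub>0 int"

definition Var :: "'v \<Rightarrow> 'v ring_term" where
  "Var v = Poly_Mapping.single (Poly_Mapping.single v 1) 1"

definition subst :: "('v \<Rightarrow> 'w ring_term) \<Rightarrow> 'v ring_term \<Rightarrow> 'w ring_term" where
  "subst \<sigma> p = (\<Sum>m\<in>Poly_Mapping.keys p. of_int (Poly_Mapping.lookup p m) *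
                  (\<Prod>v\<in>Poly_Mapping.keys m. \<sigma> v ^ Poly_Mapping.lookup m v))"

text \<open>
  The set of generators is a subset of a type, so that it may also be empty;
  \<open>closed_terms G\<close> is the polynomial ring over the integers with indeterminates in \<open>G\<close>.
\<close>

definition closed_terms :: "'g set \<Rightarrow> 'g ring_term set" where
  "closed_terms G = {p. \<forall>m\<in>Poly_Mapping.keys p. Poly_Mapping.keys m \<subseteq> G}"

lemma subst_0 [simp]: "subst \<sigma> 0 = 0"
  by (simp add: subst_def)

lemma subst_1 [simp]: "subst \<sigma> 1 = 1"
  by (simp add: subst_def)

lemma subst_Var [simp]: "subst \<sigma> (Var v) = \<sigma> v"
  by (simp add: subst_def Var_def)

lemma subst_superset:
  assumes "finite S" "Poly_Mapping.keys p \<subseteq> S"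
  shows "subst \<sigma> p = (\<Sum>m\<in>S. of_int (Poly_Mapping.lookup p m) *
                       (\<Prod>v\<in>Poly_Mapping.keys m. \<sigma> v ^ Poly_Mapping.lookup m v))"
  unfolding subst_def
  by (rule sum.mono_neutral_left) (use assms in \<open>auto simp: in_keys_iff\<close>)

lemma subst_add [simp]: "subst \<sigma> (p + q) = subst \<sigma> p + subst \<sigma> q"
proof -
  let ?S = "Poly_Mapping.keys p \<union> Poly_Mapping.keys q"
  have "Poly_Mapping.keys (p + q) \<subseteq> ?S" by (rule Poly_Mapping.keys_add)
  then show ?thesis
    by (simp add: subst_superset[of ?S] lookup_add sum.distrib distrib_right)
qed

lemma subst_uminus [simp]: "subst \<sigma> (- p) = - subst \<sigma> p"
  by (simp add: subst_def sum_negf)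

lemma subst_diff [simp]: "subst \<sigma> (p - q) = subst \<sigma> p - subst \<sigma> q"
  using subst_add[of \<sigma> p "- q"] by simp

lemma prod_keys_superset:
  assumes "finite S" "Poly_Mapping.keys m \<subseteq> S"
  shows "(\<Prod>v\<in>Poly_Mapping.keys m. (\<sigma> v :: 'w ring_term) ^ Poly_Mapping.lookup m v) =
         (\<Prod>v\<in>S. \<sigma> v ^ Poly_Mapping.lookup m v)"
  by (rule prod.mono_neutral_left) (use assms in \<open>auto simp: in_keys_iff\<close>)

lemma subst_single:
  "subst \<sigma> (Poly_Mapping.single m c) =
   of_int c * (\<Prod>v\<in>Poly_Mapping.keys m. \<sigma> v ^ Poly_Mapping.lookup m v)"
  by (simp add: subst_def)

lemma subst_mult_single:
  "subst \<sigma> (Poly_Mapping.single m c * Poly_Mapping.single n d) =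
   subst \<sigma> (Poly_Mapping.single m c) * subst \<sigma> (Poly_Mapping.single n d)"
proof -
  let ?S = "Poly_Mapping.keys m \<union> Poly_Mapping.keys n"
  have "Poly_Mapping.keys (m + n) \<subseteq> ?S" by (rule Poly_Mapping.keys_add)
  then have "(\<Prod>v\<in>Poly_Mapping.keys (m + n). \<sigma> v ^ Poly_Mapping.lookup (m + n) v) =
             (\<Prod>v\<in>?S. \<sigma> v ^ Poly_Mapping.lookup (m + n) v)"
    by (intro prod_keys_superset) auto
  also have "\<dots> = (\<Prod>v\<in>?S. \<sigma> v ^ Poly_Mapping.lookup m v) *
                  (\<Prod>v\<in>?S. \<sigma> v ^ Poly_Mapping.lookup n v)"
    by (simp add: lookup_add power_add prod.distrib)
  finally show ?thesis
    by (simp add: subst_single mult_single prod_keys_superset[of ?S m]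
        prod_keys_superset[of ?S n] ac_simps)
qed

lemma ring_term_induct [case_names single add]:
  fixes p :: "'v ring_term"
  assumes single: "\<And>m c. P (Poly_Mapping.single m c)"
    and add: "\<And>p q. P p \<Longrightarrow> P q \<Longrightarrow> P (p + q)"
  shows "P p"
proof (induction p rule: update_induct)
  case const
  then show ?case using single[of _ 0] by simp
next
  case (update f m c)
  have "Poly_Mapping.update m c f = f + Poly_Mapping.single m c"
    using update(1)
    by (intro poly_mapping_eqI)
       (auto simp: lookup_update lookup_add lookup_single in_keys_iff when_def)
  then show ?case using add[OF update(3) single] by simp
qed

lemma subst_mult [simp]: "subst \<sigma> (p * q) = subst \<sigma> p * subst \<sigma> q"
proof (induction p rule: ring_term_induct)
  case (single m c)
  show ?case
    by (induction q rule: ring_term_induct) (simp_all add: subst_mult_single distrib_left)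
qed (simp add: distrib_right)

lemma subst_power [simp]: "subst \<sigma> (p ^ n) = subst \<sigma> p ^ n"
  by (induction n) simp_all


section \<open>Dynamical theories\<close>

text \<open>The logical constant False is an atomic formula without arguments.\<close>

datatype 't atom = Falsum | EqZ 't | Ide nat 't | Ndz nat 't

text \<open>
  \<open>H \<turnstile> [A\<^sub>1, \<dots>, A\<^sub>k]\<close> is the rule whose premise is the conjunction of \<open>H\<close> and whose conclusion
  is the disjunction of the conjunctions \<open>A\<^sub>1, \<dots>, A\<^sub>k\<close>.
\<close>

datatype dyn_axiom =
  Rule "nat ring_term atom list" "nat ring_term atom list list"  (infix \<open>\<turnstile>\<close> 50)

definition facts :: "'g set \<Rightarrow> 'g ring_term atom set" where
  "facts G = {Falsum} \<union> EqZ ` closed_terms G \<union>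
             (\<Union>i\<in>{1..3}. Ide i ` closed_terms G \<union> Ndz i ` closed_terms G)"

definition presentation :: "'g set \<Rightarrow> 'g ring_term atom set \<Rightarrow> bool" where
  "presentation G R \<longleftrightarrow> R \<subseteq> facts G"

text \<open>Every node of a tree is labelled with the set of facts that are valid there.\<close>

datatype 'f tree = Leaf "'f set" | Node "'f set" "'f tree list"

primrec valid_facts :: "'f tree \<Rightarrow> 'f set" where
  "valid_facts (Leaf F) = F"
| "valid_facts (Node F ts) = F"

primrec leaves :: "'f tree \<Rightarrow> 'f set set" where
  "leaves (Leaf F) = {F}"
| "leaves (Node F ts) = \<Union> (set (map leaves ts))"

inductive evaluation_tree :: "dyn_axiom set \<Rightarrow> 'g set \<Rightarrow> 'g ring_term atom tree \<Rightarrow> bool"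
  for T G where
  leaf: "evaluation_tree T G (Leaf F)"
| step: "evaluation_tree T G (Node F ts)"
  if "(H \<turnstile> As) \<in> T" and "\<forall>v. \<sigma> v \<in> closed_terms G"
    and "map_atom (subst \<sigma>) ` set H \<subseteq> F"
    and "list_all2 (\<lambda>A t. valid_facts t = F \<union> map_atom (subst \<sigma>) ` set A \<and>
                          evaluation_tree T G t) As ts"

definition dynamical_evaluation ::
    "dyn_axiom set \<Rightarrow> 'g set \<Rightarrow> 'g ring_term atom set \<Rightarrow> 'g ring_term atom tree \<Rightarrow> bool" where
  "dynamical_evaluation T G R t \<longleftrightarrow> evaluation_tree T G t \<and> valid_facts t = R"

definition true_fact ::
    "dyn_axiom set \<Rightarrow> 'g set \<Rightarrow> 'g ring_term atom set \<Rightarrow> 'g ring_term atom \<Rightarrow> bool" where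
  "true_fact T G R \<phi> \<longleftrightarrow> (\<exists>t. dynamical_evaluation T G R t \<and> (\<forall>F\<in>leaves t. \<phi> \<in> F))"

definition collapses :: "dyn_axiom set \<Rightarrow> 'g set \<Rightarrow> 'g ring_term atom set \<Rightarrow> bool" where
  "collapses T G R \<longleftrightarrow> (\<exists>t. dynamical_evaluation T G R t \<and> (\<forall>F\<in>leaves t. Falsum \<in> F))"

text \<open>The type argument is the type from which the generators are taken.\<close>

definition collapse_simultaneously ::
    "'g itself \<Rightarrow> dyn_axiom set \<Rightarrow> dyn_axiom set \<Rightarrow> bool" where
  "collapse_simultaneously _ T T' \<longleftrightarrow>
     (\<forall>(G :: 'g set) R. presentation G R \<longrightarrow> (collapses T G R \<longleftrightarrow> collapses T' G R))"

definition prove_same_facts :: "'g itself \<Rightarrow> dyn_axiom set \<Rightarrow> dyn_axiom set \<Rightarrow> bool" where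
  "prove_same_facts _ T T' \<longleftrightarrow>
     (\<forall>(G :: 'g set) R. presentation G R \<longrightarrow>
        {\<phi> \<in> facts G. true_fact T G R \<phi>} = {\<phi> \<in> facts G. true_fact T' G R \<phi>})"


section \<open>The theories\<close>

abbreviation "vx \<equiv> (Var 0 :: nat ring_term)"
abbreviation "vy \<equiv> (Var 1 :: nat ring_term)"
abbreviation "va \<equiv> (Var 2 :: nat ring_term)"

definition Ax_False :: "dyn_axiom set" where
  "Ax_False = {[Falsum] \<turnstile> [[EqZ vx]]} \<union>
     (\<Union>i\<in>{1..3}. {[Falsum] \<turnstile> [[Ide i vx]], [Falsum] \<turnstile> [[Ndz i vx]]})"

definition A0 :: "dyn_axiom set" where
  "A0 = {[] \<turnstile> [[EqZ 0]],
         [EqZ vx, EqZ vy] \<turnstile> [[EqZ (vx + vy)]],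
         [EqZ vx] \<turnstile> [[EqZ (va * vx)]],
         [EqZ 1] \<turnstile> [[Falsum]]}"

definition A1 :: "dyn_axiom set" where
  "A1 = (\<Union>i\<in>{1..3}.
          {[EqZ vx] \<turnstile> [[Ide i vx]],
           [Ide i vx, Ide i vy] \<turnstile> [[Ide i (vx + vy)]],
           [Ide i vx] \<turnstile> [[Ide i (va * vx)]],
           [Ide i 1] \<turnstile> [[Falsum]],
           [] \<turnstile> [[Ndz i 1]],
           [Ndz i vx, Ndz i vy] \<turnstile> [[Ndz i (vx * vy)]],
           [EqZ vx, Ndz i vy] \<turnstile> [[Ndz i (vx + vy)]]}) \<union>
        (\<Union>i\<in>{1..2}. {[Ide i vx] \<turnstile> [[Ide (i + 1) vx]]})"

definition A2 :: "dyn_axiom set" where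
  "A2 = (\<Union>i\<in>{1..3}.
          {[Ndz i 0] \<turnstile> [[Falsum]],
           [Ide i vx, Ndz i vy] \<turnstile> [[Ndz i (vx + vy)]]}) \<union>
        (\<Union>i\<in>{1..2}. {[Ndz (i + 1) vx] \<turnstile> [[Ndz i vx]]})"

definition A3 :: "dyn_axiom set" where
  "A3 = (\<Union>i\<in>{1..3}. {[Ide i (vx * vy), Ndz i vy] \<turnstile> [[Ide i vx]]})"

definition A4 :: "dyn_axiom set" where
  "A4 = (\<Union>i\<in>{1..3}.
          {[Ndz i (vx * vy)] \<turnstile> [[Ndz i vx, Ndz i vy]],
           [Ide i (vx ^ 2)] \<turnstile> [[Ide i vx]]})"

definition A5 :: "dyn_axiom set" where
  "A5 = (\<Union>i\<in>{1..3}. {[] \<turnstile> [[Ide i vx], [Ndz i vx]]})"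

definition P3_dir :: "dyn_axiom set" where
  "P3_dir = Ax_False \<union> A0 \<union> A1 \<union> A2"

definition P3_dyn1 :: "dyn_axiom set" where
  "P3_dyn1 = Ax_False \<union> A0 \<union> A1 \<union> A2 \<union> A5"

definition P3_sim1 :: "dyn_axiom set" where
  "P3_sim1 = Ax_False \<union> A0 \<union> A1 \<union> A2 \<union> A3 \<union> A4"

definition P3_sim2 :: "dyn_axiom set" where
  "P3_sim2 = Ax_False \<union> A0 \<union> A1 \<union> A3"

end

theory Submission
  imports Defs
begin

text \<open>
  The common semantics of the four theories are the chains of prime ideals
  \<open>P\<^sub>1 \<subseteq> P\<^sub>2 \<subseteq> P\<^sub>3\<close> of \<open>\<int>[G]\<close>, where \<open>Ide i\<close> means membership in \<open>P\<^sub>i\<close>, \<open>Ndz i\<close> means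
  non-membership in \<open>P\<^sub>i\<close>, and the terms declared null form some ideal inside \<open>P\<^sub>1\<close>. Such a chain
  satisfies every axiom of every one of the theories, so a presentation that has a model cannot
  collapse in any of them.

  Conversely, ideals \<open>I\<^sub>i\<close> and multiplicative monoids \<open>M\<^sub>i\<close> can be separated by a chain of primes,
  \<open>I\<^sub>i \<subseteq> P\<^sub>i\<close> and \<open>P\<^sub>i \<inter> M\<^sub>i = \<emptyset>\<close>, unless there is an algebraic certificate
  \<open>u\<^sub>1 (u\<^sub>2 (u\<^sub>3 + j\<^sub>3) + j\<^sub>2) + j\<^sub>1 = 0\<close> with \<open>u\<^sub>i \<in> M\<^sub>i\<close> and \<open>j\<^sub>i \<in> I\<^sub>i\<close> (\<open>exists_prime_chain\<close>).
  Take for \<open>I\<^sub>i\<close> and \<open>M\<^sub>i\<close> the terms for which \<open>Ide i\<close> and \<open>Ndz i\<close> are derivable. A certificate is then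
  a derivation of \<open>False\<close> already in the two weak theories. The direct theory reads it from the
  inside out: each bracket lies in a monoid, so \<open>Ndz 1\<close> holds of \<open>0\<close>. The theory with
  cancellation \<open>A3\<close> reads it from the outside in: each factor \<open>u\<^sub>i\<close> is cancelled, so \<open>Ide 3\<close> holds
  of \<open>1\<close>. As the other two theories extend the direct one, all four collapse exactly when
  there is no model.

  The same argument makes the two strong theories complete for facts: a fact that holds in all models
  is derivable. In \<open>P3_dyn1\<close>, the disjunction \<open>A5\<close> reduces this to collapse after adding the
  opposite fact. In \<open>P3_sim1\<close>, one enlarges the monoid or ideal so as to force
  \<open>x \<notin> P\<^sub>i\<close> or \<open>x \<in> P\<^sub>i\<close>, and turns a resulting certificate into a derivation of \<open>Ide i x\<close> or
  \<open>Ndz i x\<close>, using that the derivable ideals are radical and the derivable monoids saturated.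
  So these two theories prove the same facts.
\<close>

section \<open>Prime ideals of a subring\<close>

lemma index_set: "{1..3} = {1, 2, 3::nat}"
  by auto

text \<open>
  The generators are a subset of a type, so the closed terms are only a subring of the ring of all
  polynomials over that type. Ideals and primes are therefore taken relative to a subring.
\<close>

locale unital_subring =
  fixes A :: "'a::comm_ring_1 set"
  assumes one_mem: "1 \<in> A"
    and add_mem: "x \<in> A \<Longrightarrow> y \<in> A \<Longrightarrow> x + y \<in> A"
    and mult_mem: "x \<in> A \<Longrightarrow> y \<in> A \<Longrightarrow> x * y \<in> A"
    and uminus_mem: "x \<in> A \<Longrightarrow> - x \<in> A"
begin

lemma zero_mem: "0 \<in> A"
  using add_mem[OF one_mem uminus_mem[OF one_mem]] by simp

lemma power_mem: "x \<in> A \<Longrightarrow> x ^ n \<in> A"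
  by (induction n) (auto intro: one_mem mult_mem)

definition ideal :: "'a set \<Rightarrow> bool" where
  "ideal I \<longleftrightarrow> I \<subseteq> A \<and> 0 \<in> I \<and> (\<forall>x\<in>I. \<forall>y\<in>I. x + y \<in> I) \<and> (\<forall>a\<in>A. \<forall>x\<in>I. a * x \<in> I)"

definition prime_ideal :: "'a set \<Rightarrow> bool" where
  "prime_ideal P \<longleftrightarrow> ideal P \<and> 1 \<notin> P \<and> (\<forall>x\<in>A. \<forall>y\<in>A. x * y \<in> P \<longrightarrow> x \<in> P \<or> y \<in> P)"

definition submonoid :: "'a set \<Rightarrow> bool" where
  "submonoid S \<longleftrightarrow> S \<subseteq> A \<and> 1 \<in> S \<and> (\<forall>x\<in>S. \<forall>y\<in>S. x * y \<in> S)"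

lemma ideal_subset: "ideal I \<Longrightarrow> x \<in> I \<Longrightarrow> x \<in> A"
  and ideal_zero: "ideal I \<Longrightarrow> 0 \<in> I"
  and ideal_add: "ideal I \<Longrightarrow> x \<in> I \<Longrightarrow> y \<in> I \<Longrightarrow> x + y \<in> I"
  and ideal_mult: "ideal I \<Longrightarrow> a \<in> A \<Longrightarrow> x \<in> I \<Longrightarrow> a * x \<in> I"
  by (auto simp: ideal_def)

lemma ideal_mult_right: "ideal I \<Longrightarrow> a \<in> A \<Longrightarrow> x \<in> I \<Longrightarrow> x * a \<in> I"
  using ideal_mult[of I a x] by (simp add: mult.commute)

lemma ideal_uminus: "ideal I \<Longrightarrow> x \<in> I \<Longrightarrow> - x \<in> I"
  using ideal_mult[of I "- 1" x] uminus_mem[OF one_mem] by simp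

lemma submonoid_subset: "submonoid S \<Longrightarrow> x \<in> S \<Longrightarrow> x \<in> A"
  and submonoid_one: "submonoid S \<Longrightarrow> 1 \<in> S"
  and submonoid_mult: "submonoid S \<Longrightarrow> x \<in> S \<Longrightarrow> y \<in> S \<Longrightarrow> x * y \<in> S"
  by (auto simp: submonoid_def)

lemma prime_ideal_ideal: "prime_ideal P \<Longrightarrow> ideal P"
  and prime_ideal_one: "prime_ideal P \<Longrightarrow> 1 \<notin> P"
  and prime_ideal_cases: "prime_ideal P \<Longrightarrow> x \<in> A \<Longrightarrow> y \<in> A \<Longrightarrow> x * y \<in> P \<Longrightarrow> x \<in> P \<or> y \<in> P"
  by (auto simp: prime_ideal_def)

definition ideal_sum :: "'a set \<Rightarrow> 'a set \<Rightarrow> 'a set" where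
  "ideal_sum I J = {x + y | x y. x \<in> I \<and> y \<in> J}"

lemma ideal_ideal_sum:
  assumes "ideal I" "ideal J"
  shows "ideal (ideal_sum I J)"
  unfolding ideal_def
proof (intro conjI ballI)
  show "ideal_sum I J \<subseteq> A"
    using assms by (auto simp: ideal_sum_def intro: add_mem ideal_subset)
  show "0 \<in> ideal_sum I J"
    using assms[THEN ideal_zero] unfolding ideal_sum_def by force
next
  fix s t assume "s \<in> ideal_sum I J" "t \<in> ideal_sum I J"
  then obtain x y x' y' where "x \<in> I" "y \<in> J" "x' \<in> I" "y' \<in> J" "s = x + y" "t = x' + y'"
    by (auto simp: ideal_sum_def)
  moreover have "(x + y) + (x' + y') = (x + x') + (y + y')" by (simp add: ac_simps)
  ultimately show "s + t \<in> ideal_sum I J"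
    unfolding ideal_sum_def using assms ideal_add by blast
next
  fix a s assume "a \<in> A" "s \<in> ideal_sum I J"
  then show "a * s \<in> ideal_sum I J"
    unfolding ideal_sum_def using assms ideal_mult by (fastforce simp: distrib_left)
qed

lemma ideal_sum_left: "ideal J \<Longrightarrow> I \<subseteq> ideal_sum I J"
  unfolding ideal_sum_def by (force dest: ideal_zero)

lemma ideal_sum_right: "ideal I \<Longrightarrow> J \<subseteq> ideal_sum I J"
  unfolding ideal_sum_def by (force dest: ideal_zero)

definition principal :: "'a \<Rightarrow> 'a set" where
  "principal x = {a * x | a. a \<in> A}"

lemma ideal_principal: "x \<in> A \<Longrightarrow> ideal (principal x)"
  unfolding ideal_def principal_def
proof (intro conjI ballI, goal_cases)
  case 1 then show ?case by (auto intro: mult_mem)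
next
  case 2 then show ?case using zero_mem by force
next
  case (3 s t)
  then show ?case by (auto simp: distrib_right[symmetric] intro: add_mem)
next
  case (4 a s)
  then show ?case by (auto simp: mult.assoc[symmetric] intro: mult_mem)
qed

lemma mem_principal: "x \<in> principal x"
  unfolding principal_def using one_mem by force

text \<open>
  An ideal that is maximal among those disjoint from a multiplicative set is prime: if \<open>x\<close> and \<open>y\<close>
  lie outside, then enlarging the ideal by either of them meets the set, and the product of the
  two witnesses lies in the set and, if \<open>x y\<close> were in the ideal, also in the ideal.
\<close>

lemma exists_prime_ideal:
  assumes I: "ideal I" and S: "submonoid S" and disj: "I \<inter> S = {}"
  shows "\<exists>P. prime_ideal P \<and> I \<subseteq> P \<and> P \<inter> S = {}"
proof -
  let ?F = "{J. ideal J \<and> I \<subseteq> J \<and> J \<inter> S = {}}"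
  have "\<exists>P\<in>?F. \<forall>J\<in>?F. P \<subseteq> J \<longrightarrow> J = P"
  proof (rule subset_Zorn_nonempty)
    show "?F \<noteq> {}" using I disj by blast
  next
    fix \<C> assume ne: "\<C> \<noteq> {}" and ch: "subset.chain ?F \<C>"
    have sub: "\<And>J. J \<in> \<C> \<Longrightarrow> ideal J \<and> I \<subseteq> J \<and> J \<inter> S = {}"
      and tot: "\<And>J K. J \<in> \<C> \<Longrightarrow> K \<in> \<C> \<Longrightarrow> J \<subseteq> K \<or> K \<subseteq> J"
      using ch by (auto simp: subset_chain_def)
    have "ideal (\<Union>\<C>)"
      unfolding ideal_def
    proof (intro conjI ballI)
      show "\<Union>\<C> \<subseteq> A" using sub ideal_subset by blast
      show "0 \<in> \<Union>\<C>" using ne sub ideal_zero by blast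
      show "x + y \<in> \<Union>\<C>" if xy: "x \<in> \<Union>\<C>" "y \<in> \<Union>\<C>" for x y
      proof -
        obtain J K where JK: "J \<in> \<C>" "K \<in> \<C>" "x \<in> J" "y \<in> K" using xy by blast
        then have "x + y \<in> J \<or> x + y \<in> K"
          using tot[of J K] sub[of J] sub[of K] by (auto intro: ideal_add)
        then show ?thesis using JK by blast
      qed
      show "a * x \<in> \<Union>\<C>" if "a \<in> A" "x \<in> \<Union>\<C>" for a x
        using that sub ideal_mult by blast
    qed
    then show "\<Union>\<C> \<in> ?F" using ne sub by blast
  qed
  then obtain P where P: "ideal P" "I \<subseteq> P" "P \<inter> S = {}"
    and max: "\<And>J. ideal J \<Longrightarrow> I \<subseteq> J \<Longrightarrow> J \<inter> S = {} \<Longrightarrow> P \<subseteq> J \<Longrightarrow> J = P"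
    by (auto 4 4)
  have meets: "\<exists>p\<in>P. \<exists>a\<in>A. p + a * x \<in> S" if x: "x \<in> A" "x \<notin> P" for x
  proof -
    let ?J = "ideal_sum P (principal x)"
    have px: "ideal (principal x)" using x by (rule_tac ideal_principal)
    have sup: "P \<subseteq> ?J" "x \<in> ?J"
      using ideal_sum_left[OF px] ideal_sum_right[OF P(1)] mem_principal by blast+
    then have "?J \<inter> S \<noteq> {}"
      using max[of ?J] ideal_ideal_sum[OF P(1) px] P(2) x by blast
    then show ?thesis unfolding ideal_sum_def principal_def by blast
  qed
  have "x \<in> P \<or> y \<in> P" if xy: "x \<in> A" "y \<in> A" "x * y \<in> P" for x y
  proof (rule ccontr)
    assume "\<not> (x \<in> P \<or> y \<in> P)"
    then obtain p a q b where
      pa: "p \<in> P" "a \<in> A" "p + a * x \<in> S" and qb: "q \<in> P" "b \<in> A" "q + b * y \<in> S"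
      using meets xy by meson
    have "(q + b * y) * p + (a * x) * q + (a * b) * (x * y) \<in> P"
      using P(1) xy pa qb
      by (simp add: ideal_add ideal_mult mult_mem add_mem ideal_subset[OF P(1)])
    also have "(q + b * y) * p + (a * x) * q + (a * b) * (x * y) = (p + a * x) * (q + b * y)"
      by (simp add: algebra_simps)
    finally show False
      using submonoid_mult[OF S pa(3) qb(3)] P(3) by blast
  qed
  moreover have "1 \<notin> P" using P(3) submonoid_one[OF S] by blast
  ultimately show ?thesis using P unfolding prime_ideal_def by blast
qed

text \<open>
  A prime disjoint from \<open>U\<close> that is to be contained in a prime that contains \<open>J\<close> and avoids \<open>S\<close>
  must avoid all the products \<open>u (s + j)\<close>. Conversely, avoiding them suffices. As
  they form a multiplicative set again, the requirements on the later members of a chain can be pushed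
  back, one after the other, to its first member.
\<close>

definition obstruction :: "'a set \<Rightarrow> 'a set \<Rightarrow> 'a set \<Rightarrow> 'a set" where
  "obstruction U S J = {u * (s + j) | u s j. u \<in> U \<and> s \<in> S \<and> j \<in> J}"

lemma submonoid_obstruction:
  assumes U: "submonoid U" and S: "submonoid S" and J: "ideal J"
  shows "submonoid (obstruction U S J)"
  unfolding submonoid_def
proof (intro conjI ballI)
  show "obstruction U S J \<subseteq> A"
    using assms unfolding obstruction_def
    by (auto intro!: mult_mem add_mem intro: submonoid_subset ideal_subset)
  have "1 * (1 + 0) \<in> obstruction U S J"
    using assms unfolding obstruction_def by (blast intro: submonoid_one ideal_zero)
  then show "1 \<in> obstruction U S J" by simp
next
  fix x y assume "x \<in> obstruction U S J" "y \<in> obstruction U S J"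
  then obtain u s j v t k where *: "u \<in> U" "s \<in> S" "j \<in> J" "v \<in> U" "t \<in> S" "k \<in> J"
    "x = u * (s + j)" "y = v * (t + k)"
    by (auto simp: obstruction_def)
  have "s * k + t * j + j * k \<in> J"
    using * S J by (intro ideal_add ideal_mult) (auto dest: submonoid_subset ideal_subset)
  moreover have "x * y = (u * v) * (s * t + (s * k + t * j + j * k))"
    using * by (simp add: algebra_simps)
  ultimately show "x * y \<in> obstruction U S J"
    unfolding obstruction_def using * U S submonoid_mult by blast
qed

lemma obstruction_disjoint:
  assumes S: "submonoid S" and J: "ideal J" and Q: "ideal Q"
    and disj: "Q \<inter> obstruction U S J = {}"
  shows "Q \<inter> U = {}"
proof -
  have False if "u \<in> Q" "u \<in> U" for u
  proof -
    have "u * (1 + 0) \<in> obstruction U S J"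
      unfolding obstruction_def using that S J by (blast intro: submonoid_one ideal_zero)
    then show False using disj that by auto
  qed
  then show ?thesis by blast
qed

text \<open>
  If \<open>q + j = s\<close> for \<open>q \<in> Q\<close>, \<open>j \<in> J\<close> and \<open>s \<in> S\<close>, then \<open>q = 1 (s - j)\<close> would be an obstruction. So
  \<open>Q + J\<close> is disjoint from \<open>S\<close>.
\<close>

lemma exists_prime_ideal_above:
  assumes U: "submonoid U" and S: "submonoid S" and J: "ideal J" and Q: "ideal Q"
    and disj: "Q \<inter> obstruction U S J = {}"
  shows "\<exists>P. prime_ideal P \<and> Q \<subseteq> P \<and> J \<subseteq> P \<and> P \<inter> S = {}"
proof -
  have "q + j \<notin> S" if "q \<in> Q" "j \<in> J" for q j
  proof
    assume "q + j \<in> S"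
    then have "1 * ((q + j) + - j) \<in> obstruction U S J"
      unfolding obstruction_def using that U J by (blast intro: submonoid_one ideal_uminus)
    then show False using disj that by auto
  qed
  then have "ideal_sum Q J \<inter> S = {}" unfolding ideal_sum_def by blast
  from exists_prime_ideal[OF ideal_ideal_sum[OF Q J] S this]
  show ?thesis using ideal_sum_left[OF J, of Q] ideal_sum_right[OF Q, of J] by blast
qed

definition collapse_certificate :: "(nat \<Rightarrow> 'a set) \<Rightarrow> (nat \<Rightarrow> 'a set) \<Rightarrow> bool" where
  "collapse_certificate I M \<longleftrightarrow>
     (\<exists>u\<^sub>1\<in>M 1. \<exists>u\<^sub>2\<in>M 2. \<exists>u\<^sub>3\<in>M 3. \<exists>j\<^sub>1\<in>I 1. \<exists>j\<^sub>2\<in>I 2. \<exists>j\<^sub>3\<in>I 3.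
        u\<^sub>1 * (u\<^sub>2 * (u\<^sub>3 + j\<^sub>3) + j\<^sub>2) + j\<^sub>1 = 0)"

definition prime_chain :: "(nat \<Rightarrow> 'a set) \<Rightarrow> bool" where
  "prime_chain P \<longleftrightarrow> (\<forall>i\<in>{1..3}. prime_ideal (P i)) \<and> P 1 \<subseteq> P 2 \<and> P 2 \<subseteq> P 3"

text \<open>
  The absence of a certificate says that \<open>I\<^sub>1\<close> avoids the obstruction of the whole chain. The primes are
  then chosen from the bottom upwards, each avoiding the obstruction of the members above it.
\<close>

lemma exists_prime_chain:
  assumes I: "\<And>i. i \<in> {1..3} \<Longrightarrow> ideal (I i)"
    and M: "\<And>i. i \<in> {1..3} \<Longrightarrow> submonoid (M i)"
    and cert: "\<not> collapse_certificate I M"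
  shows "\<exists>P. prime_chain P \<and> (\<forall>i\<in>{1..3}. I i \<subseteq> P i \<and> P i \<inter> M i = {})"
proof -
  note M' = M[of 1] M[of 2] M[of 3] and I' = I[of 1] I[of 2] I[of 3]
  define S\<^sub>2 where "S\<^sub>2 = obstruction (M 2) (M 3) (I 3)"
  define S\<^sub>1 where "S\<^sub>1 = obstruction (M 1) S\<^sub>2 (I 2)"
  have S\<^sub>2: "submonoid S\<^sub>2" unfolding S\<^sub>2_def using M' I' by (simp add: submonoid_obstruction)
  have S\<^sub>1: "submonoid S\<^sub>1" unfolding S\<^sub>1_def using M' I' S\<^sub>2 by (simp add: submonoid_obstruction)
  have "I 1 \<inter> S\<^sub>1 = {}"
  proof -
    have False if x: "x \<in> I 1" "x \<in> S\<^sub>1" for x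
    proof -
      obtain u\<^sub>1 u\<^sub>2 u\<^sub>3 j\<^sub>2 j\<^sub>3 where *: "u\<^sub>1 \<in> M 1" "u\<^sub>2 \<in> M 2" "u\<^sub>3 \<in> M 3" "j\<^sub>2 \<in> I 2" "j\<^sub>3 \<in> I 3"
        "x = u\<^sub>1 * (u\<^sub>2 * (u\<^sub>3 + j\<^sub>3) + j\<^sub>2)"
        using x(2) unfolding S\<^sub>1_def S\<^sub>2_def obstruction_def by blast
      then have "u\<^sub>1 * (u\<^sub>2 * (u\<^sub>3 + j\<^sub>3) + j\<^sub>2) + - x = 0" by simp
      moreover have "- x \<in> I 1" using x I' by (simp add: ideal_uminus)
      ultimately show False using cert * unfolding collapse_certificate_def by blast
    qed
    then show ?thesis by blast
  qed
  then obtain P\<^sub>1 where P\<^sub>1: "prime_ideal P\<^sub>1" "I 1 \<subseteq> P\<^sub>1" "P\<^sub>1 \<inter> S\<^sub>1 = {}"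
    using exists_prime_ideal[OF _ S\<^sub>1, of "I 1"] I' by auto
  obtain P\<^sub>2 where P\<^sub>2: "prime_ideal P\<^sub>2" "P\<^sub>1 \<subseteq> P\<^sub>2" "I 2 \<subseteq> P\<^sub>2" "P\<^sub>2 \<inter> S\<^sub>2 = {}"
    using exists_prime_ideal_above[of "M 1" S\<^sub>2 "I 2" P\<^sub>1] M' I' S\<^sub>2 P\<^sub>1 prime_ideal_ideal
    unfolding S\<^sub>1_def by auto
  obtain P\<^sub>3 where P\<^sub>3: "prime_ideal P\<^sub>3" "P\<^sub>2 \<subseteq> P\<^sub>3" "I 3 \<subseteq> P\<^sub>3" "P\<^sub>3 \<inter> M 3 = {}"
    using exists_prime_ideal_above[of "M 2" "M 3" "I 3" P\<^sub>2] M' I' P\<^sub>2 prime_ideal_ideal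
    unfolding S\<^sub>2_def by auto
  have "P\<^sub>1 \<inter> M 1 = {}"
    using obstruction_disjoint[of S\<^sub>2 "I 2" P\<^sub>1 "M 1"] S\<^sub>2 I' P\<^sub>1 prime_ideal_ideal
    unfolding S\<^sub>1_def by auto
  moreover have "P\<^sub>2 \<inter> M 2 = {}"
    using obstruction_disjoint[of "M 3" "I 3" P\<^sub>2 "M 2"] M' I' P\<^sub>2 prime_ideal_ideal
    unfolding S\<^sub>2_def by auto
  ultimately show ?thesis
    using P\<^sub>1 P\<^sub>2 P\<^sub>3
    by (intro exI[of _ "\<lambda>i. if i = 1 then P\<^sub>1 else if i = 2 then P\<^sub>2 else P\<^sub>3"])
       (simp add: prime_chain_def index_set del: One_nat_def)
qed

end

lemma unital_subring_closed_terms: "unital_subring (closed_terms G)"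
proof
  show "1 \<in> closed_terms G" by (simp add: closed_terms_def)
next
  fix x y assume xy: "x \<in> closed_terms G" "y \<in> closed_terms G"
  show "x + y \<in> closed_terms G"
    using xy Poly_Mapping.keys_add[of x y] unfolding closed_terms_def by blast
  show "x * y \<in> closed_terms G"
    unfolding closed_terms_def
  proof (intro CollectI ballI)
    fix m assume "m \<in> Poly_Mapping.keys (x * y)"
    then obtain k l where "m = k + l" "k \<in> Poly_Mapping.keys x" "l \<in> Poly_Mapping.keys y"
      using keys_mult[of x y] by auto
    then show "Poly_Mapping.keys m \<subseteq> G"
      using xy Poly_Mapping.keys_add[of k l] unfolding closed_terms_def by blast
  qed
next
  fix x assume "x \<in> closed_terms G"
  then show "- x \<in> closed_terms G" by (simp add: closed_terms_def)
qed

interpretation terms: unital_subring "closed_terms G" for G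
  by (rule unital_subring_closed_terms)


section \<open>Derivability\<close>

text \<open>
  An evaluation tree whose leaves all contain a given fact is a derivation of this fact from the
  label of its root. Stated for one fact, this is an inductive predicate without trees, for which
  weakening and cut are plain inductions.
\<close>

inductive derives ::
    "dyn_axiom set \<Rightarrow> 'g set \<Rightarrow> 'g ring_term atom set \<Rightarrow> 'g ring_term atom \<Rightarrow> bool"
  for T G where
  hyp: "\<phi> \<in> R \<Longrightarrow> derives T G R \<phi>"
| rule: "derives T G R \<phi>"
  if "(H \<turnstile> As) \<in> T" and "\<forall>v. \<sigma> v \<in> closed_terms G"
    and "map_atom (subst \<sigma>) ` set H \<subseteq> R"
    and "\<And>A. A \<in> set As \<Longrightarrow> derives T G (R \<union> map_atom (subst \<sigma>) ` set A) \<phi>"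

lemma derives_of_evaluation_tree:
  assumes "evaluation_tree T G t" and "\<forall>F\<in>leaves t. \<phi> \<in> F"
  shows "derives T G (valid_facts t) \<phi>"
  using assms
proof (induction rule: evaluation_tree.induct)
  case (leaf F)
  then show ?case by (simp add: derives.hyp)
next
  case (step H As \<sigma> F ts)
  have "derives T G (F \<union> map_atom (subst \<sigma>) ` set A) \<phi>" if A: "A \<in> set As" for A
  proof -
    obtain k where k: "k < length As" "A = As ! k" using A by (auto simp: in_set_conv_nth)
    with step(4) have "k < length ts" by (simp add: list_all2_lengthD)
    then have "\<forall>F\<in>leaves (ts ! k). \<phi> \<in> F" using step.prems by (fastforce simp: in_set_conv_nth)
    moreover note list_all2_nthD[OF step(4) k(1)]
    ultimately show ?thesis using k by metis
  qed
  with step(1-3) show ?case by (simp add: derives.rule)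
qed

lemma evaluation_tree_of_derives:
  assumes "derives T G R \<phi>"
  shows "\<exists>t. dynamical_evaluation T G R t \<and> (\<forall>F\<in>leaves t. \<phi> \<in> F)"
  using assms
proof (induction rule: derives.induct)
  case (hyp \<phi> R)
  then show ?case
    by (intro exI[of _ "Leaf R"]) (simp add: dynamical_evaluation_def evaluation_tree.leaf)
next
  case (rule H As \<sigma> R \<phi>)
  then obtain f where f: "\<And>A. A \<in> set As \<Longrightarrow>
      dynamical_evaluation T G (R \<union> map_atom (subst \<sigma>) ` set A) (f A) \<and> (\<forall>F\<in>leaves (f A). \<phi> \<in> F)"
    by metis
  have "evaluation_tree T G (Node R (map f As))"
    using rule(1-3) f
    by (intro evaluation_tree.step[of H As T \<sigma>])
       (auto simp: list_all2_conv_all_nth dynamical_evaluation_def)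
  with f show ?case
    by (intro exI[of _ "Node R (map f As)"]) (auto simp: dynamical_evaluation_def)
qed

lemma true_fact_iff_derives: "true_fact T G R \<phi> \<longleftrightarrow> derives T G R \<phi>"
  using derives_of_evaluation_tree evaluation_tree_of_derives
  unfolding true_fact_def dynamical_evaluation_def by metis

lemma collapses_iff_derives: "collapses T G R \<longleftrightarrow> derives T G R Falsum"
  using true_fact_iff_derives[of T G R Falsum] by (simp add: true_fact_def collapses_def)

lemma derives_mono:
  assumes "derives T G R \<phi>" "R \<subseteq> R'" "T \<subseteq> T'"
  shows "derives T' G R' \<phi>"
  using assms
proof (induction arbitrary: R' rule: derives.induct)
  case (hyp \<phi> R)
  then show ?case by (auto intro: derives.hyp)
next
  case (rule H As \<sigma> R \<phi>)
  show ?case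
  proof (rule derives.rule[of H As T' \<sigma>])
    fix A assume "A \<in> set As"
    then show "derives T' G (R' \<union> map_atom (subst \<sigma>) ` set A) \<phi>"
      by (rule rule.IH) (use rule.prems in auto)
  qed (use rule in auto)
qed

lemma derives_cut:
  assumes "derives T G R \<psi>" "derives T G (insert \<psi> R) \<phi>"
  shows "derives T G R \<phi>"
  using assms
proof (induction rule: derives.induct)
  case (hyp \<psi> R)
  then show ?case by (simp add: insert_absorb)
next
  case (rule H As \<sigma> R \<psi>)
  show ?case
  proof (rule derives.rule[of H As T \<sigma>])
    fix A assume A: "A \<in> set As"
    show "derives T G (R \<union> map_atom (subst \<sigma>) ` set A) \<phi>"
      by (rule rule.IH[OF A]) (rule derives_mono[OF rule.prems], auto)
  qed (use rule in auto)
qed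

lemma derives_cut_finite:
  assumes "finite F" "\<And>\<psi>. \<psi> \<in> F \<Longrightarrow> derives T G R \<psi>" "derives T G (R \<union> F) \<phi>"
  shows "derives T G R \<phi>"
  using assms
proof (induction F rule: finite_induct)
  case (insert \<psi> F)
  have "derives T G (R \<union> F) \<phi>"
  proof (rule derives_cut)
    show "derives T G (R \<union> F) \<psi>" using insert by (auto intro: derives_mono)
  qed (use insert in simp)
  with insert show ?case by simp
qed simp

text \<open>
  Only the rules with one disjunct are considered: a set of derivable facts need not contain one of
  the disjuncts of a derivable disjunction, but it is closed under all the other rules.
\<close>

definition closed_under :: "dyn_axiom set \<Rightarrow> 'g set \<Rightarrow> 'g ring_term atom set \<Rightarrow> bool" where
  "closed_under T G C \<longleftrightarrow>
     (\<forall>H A \<sigma>. (H \<turnstile> [A]) \<in> T \<longrightarrow> (\<forall>v. \<sigma> v \<in> closed_terms G) \<longrightarrow>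
        map_atom (subst \<sigma>) ` set H \<subseteq> C \<longrightarrow> map_atom (subst \<sigma>) ` set A \<subseteq> C)"

lemma closed_under_derives:
  assumes "T' \<subseteq> T"
  shows "closed_under T' G {\<phi>. derives T G R \<phi>}"
  unfolding closed_under_def
proof (intro allI impI)
  fix H A \<sigma>
  assume ax: "(H \<turnstile> [A]) \<in> T'" and \<sigma>: "\<forall>v. \<sigma> v \<in> closed_terms G"
    and H: "map_atom (subst \<sigma>) ` set H \<subseteq> {\<phi>. derives T G R \<phi>}"
  let ?F = "map_atom (subst \<sigma>) ` set H"
  have "derives T G R \<phi>" if \<phi>: "\<phi> \<in> map_atom (subst \<sigma>) ` set A" for \<phi>
  proof (rule derives_cut_finite[of ?F])
    show "derives T G (R \<union> ?F) \<phi>"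
      by (rule derives.rule[of H "[A]" T \<sigma>])
         (use ax assms \<sigma> \<phi> in \<open>auto intro: derives.hyp\<close>)
  qed (use H in auto)
  then show "map_atom (subst \<sigma>) ` set A \<subseteq> {\<phi>. derives T G R \<phi>}" by blast
qed

text \<open>
  The axioms mention only the indeterminates 0, 1 and 2, so three closed terms determine an
  instance of an axiom.
\<close>

definition valuation :: "'t \<Rightarrow> 't \<Rightarrow> 't \<Rightarrow> nat \<Rightarrow> 't" where
  "valuation x y a v = (if v = 0 then x else if v = 1 then y else a)"

lemma closed_underD:
  assumes "closed_under T G C" "(H \<turnstile> [[\<phi>]]) \<in> T"
    and "x \<in> closed_terms G" "y \<in> closed_terms G" "a \<in> closed_terms G"
    and "\<forall>\<psi>\<in>set H. map_atom (subst (valuation x y a)) \<psi> \<in> C"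
  shows "map_atom (subst (valuation x y a)) \<phi> \<in> C"
proof -
  have "\<forall>v. valuation x y a v \<in> closed_terms G" using assms by (simp add: valuation_def)
  then have "map_atom (subst (valuation x y a)) ` set [\<phi>] \<subseteq> C"
    using assms unfolding closed_under_def by blast
  then show ?thesis by simp
qed


section \<open>Models\<close>

text \<open>
  The ideal \<open>Z\<close> interprets the equations. It is kept apart from \<open>P 1\<close> because otherwise the models
  would not separate an equation from the weaker fact with \<open>Ide 1\<close>.
\<close>

definition is_model :: "'g set \<Rightarrow> 'g ring_term set \<Rightarrow> (nat \<Rightarrow> 'g ring_term set) \<Rightarrow> bool" where
  "is_model G Z P \<longleftrightarrow> terms.ideal G Z \<and> Z \<subseteq> P 1 \<and> terms.prime_chain G P"

definition model_facts ::
    "'g set \<Rightarrow> 'g ring_term set \<Rightarrow> (nat \<Rightarrow> 'g ring_term set) \<Rightarrow> 'g ring_term atom set" where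
  "model_facts G Z P =
     EqZ ` Z \<union> (\<Union>i\<in>{1..3}. Ide i ` P i \<union> Ndz i ` (closed_terms G - P i))"

lemma model_facts_iff [simp]:
  "Falsum \<notin> model_facts G Z P"
  "EqZ x \<in> model_facts G Z P \<longleftrightarrow> x \<in> Z"
  "Ide i x \<in> model_facts G Z P \<longleftrightarrow> i \<in> {1..3} \<and> x \<in> P i"
  "Ndz i x \<in> model_facts G Z P \<longleftrightarrow> i \<in> {1..3} \<and> x \<in> closed_terms G \<and> x \<notin> P i"
  by (auto simp: model_facts_def)

definition all_axioms :: "dyn_axiom set" where
  "all_axioms = Ax_False \<union> A0 \<union> A1 \<union> A2 \<union> A3 \<union> A4 \<union> A5"

lemma axiom_holds_in_model:
  assumes model: "is_model G Z P" and ax: "(H \<turnstile> As) \<in> all_axioms"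
    and \<sigma>: "\<forall>v. \<sigma> v \<in> closed_terms G"
    and H: "map_atom (subst \<sigma>) ` set H \<subseteq> model_facts G Z P"
  shows "\<exists>A\<in>set As. map_atom (subst \<sigma>) ` set A \<subseteq> model_facts G Z P"
proof -
  have Z: "terms.ideal G Z" and ZP: "Z \<subseteq> P 1" and chain: "P 1 \<subseteq> P 2" "P 2 \<subseteq> P 3"
    and P: "\<And>i. i \<in> {1..3} \<Longrightarrow> terms.prime_ideal G (P i)"
    using model by (auto simp: is_model_def terms.prime_chain_def)
  note I = P[THEN terms.prime_ideal_ideal]
  have mono: "x \<in> P (i + 1)" if "x \<in> P i" "i \<in> {1..2}" for i x
  proof -
    from that have "i = 1 \<or> i = 2" by auto
    with that chain show ?thesis by (auto simp: numeral_eq_Suc)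
  qed
  have ZP': "x \<in> P i" if "i \<in> {1..3}" "x \<in> Z" for i x
  proof -
    from that have "i = 1 \<or> i = 2 \<or> i = 3" by auto
    with that chain ZP show ?thesis by auto
  qed
  have cancel: "y \<in> P i" if "x \<in> P i" "x + y \<in> P i" "i \<in> {1..3}" for i x y
    using terms.ideal_add[OF I[OF that(3)] terms.ideal_uminus[OF I[OF that(3)] that(1)] that(2)]
    by simp
  have cancel_null: "y \<in> P i" if "x \<in> Z" "x + y \<in> P i" "i \<in> {1..3}" for i x y
    using cancel ZP' that by blast
  have \<sigma>': "\<sigma> v \<in> closed_terms G" for v using \<sigma> by simp
  note facts = terms.ideal_zero[OF Z] terms.ideal_add[OF Z] terms.ideal_mult[OF Z]
    terms.ideal_zero[OF I] terms.ideal_add[OF I] terms.ideal_mult[OF I]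
    terms.ideal_mult_right[OF I]
    terms.prime_ideal_one[OF P] terms.one_mem terms.add_mem terms.mult_mem \<sigma>'
  have one: "1 \<notin> Z" using ZP'[of 1 1] terms.prime_ideal_one[OF P[of 1]] by auto
  have square: "x \<in> P i" if "x * x \<in> P i" "x \<in> closed_terms G" "Suc 0 \<le> i" "i \<le> 3" for i x
    using terms.prime_ideal_cases[OF P, of i x x] that by simp
  consider "(H \<turnstile> As) \<in> Ax_False" | "(H \<turnstile> As) \<in> A0" | "(H \<turnstile> As) \<in> A1" | "(H \<turnstile> As) \<in> A2"
    | "(H \<turnstile> As) \<in> A3" | "(H \<turnstile> As) \<in> A4" | "(H \<turnstile> As) \<in> A5"
    using ax unfolding all_axioms_def by blast
  then show ?thesis
  proof cases
    case 1
    then show ?thesis using H by (auto simp: Ax_False_def)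
  next
    case 2
    then show ?thesis using H one by (auto simp: A0_def facts)
  next
    case 3
    then show ?thesis using H unfolding A1_def
      by (elim UnE UN_E insertE emptyE)
         (auto simp: facts mono[simplified] ZP' dest: cancel_null terms.prime_ideal_cases[OF P, rotated -1])
  next
    case 4
    then show ?thesis using H unfolding A2_def
      by (elim UnE UN_E insertE emptyE)
         (auto simp: facts dest: cancel mono[simplified])
  next
    case 5
    then show ?thesis using H unfolding A3_def
      by (auto dest!: terms.prime_ideal_cases[OF P, rotated -1] simp: \<sigma>')
  next
    case 6
    then show ?thesis using H unfolding A4_def
      by (auto dest: square[OF _ \<sigma>'] simp: \<sigma>' facts power2_eq_square)
  next
    case 7
    then show ?thesis unfolding A5_def by (auto simp: \<sigma>')
  qed
qed

lemma derives_sound: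
  assumes "derives T G R \<phi>" "T \<subseteq> all_axioms" "is_model G Z P" "R \<subseteq> model_facts G Z P"
  shows "\<phi> \<in> model_facts G Z P"
  using assms
proof (induction rule: derives.induct)
  case (rule H As \<sigma> R \<phi>)
  then obtain A where "A \<in> set As" "map_atom (subst \<sigma>) ` set A \<subseteq> model_facts G Z P"
    using axiom_holds_in_model[OF rule.prems(2), of H As \<sigma>] by blast
  with rule.IH[of A] rule.prems show ?case by blast
qed auto


section \<open>Closed sets of facts\<close>

text \<open>
  The axioms common to all the theories make the derivable facts \<open>EqZ\<close> and \<open>Ide i\<close> into
  ideals and the derivable facts \<open>Ndz i\<close> into monoids. Stating this for closed sets of facts lets
  the theories share it.
\<close>

locale closed_facts =
  fixes G :: "'g set" and C :: "'g ring_term atom set"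
  assumes closed: "closed_under (Ax_False \<union> A0 \<union> A1) G C"
begin

abbreviation "A \<equiv> closed_terms G"

definition "nulls = {x \<in> A. EqZ x \<in> C}"
definition "ideals i = {x \<in> A. Ide i x \<in> C}"
definition "monoids i = {x \<in> A. Ndz i x \<in> C}"

lemmas closed_instance = closed_underD[OF closed]

lemma Falsum_all:
  assumes "Falsum \<in> C"
  shows "facts G \<subseteq> C"
proof -
  have "EqZ x \<in> C" if "x \<in> A" for x
    using closed_instance[of "[Falsum]" "EqZ vx" x x x] that assms
    by (auto simp: Ax_False_def valuation_def)
  moreover have "Ide i x \<in> C" if "x \<in> A" "i \<in> {1..3}" for i x
    using closed_instance[of "[Falsum]" "Ide i vx" x x x] that assms
    by (auto simp: Ax_False_def valuation_def)
  moreover have "Ndz i x \<in> C" if "x \<in> A" "i \<in> {1..3}" for i x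
    using closed_instance[of "[Falsum]" "Ndz i vx" x x x] that assms
    by (auto simp: Ax_False_def valuation_def)
  ultimately show ?thesis using assms by (auto simp: facts_def)
qed

lemma ideal_nulls: "terms.ideal G nulls"
  unfolding terms.ideal_def
proof (intro conjI ballI)
  show "nulls \<subseteq> A" by (auto simp: nulls_def)
  show "0 \<in> nulls"
    using closed_instance[of "[]" "EqZ 0" 0 0 0] terms.zero_mem
    by (auto simp: A0_def nulls_def)
  show "x + y \<in> nulls" if "x \<in> nulls" "y \<in> nulls" for x y
    using closed_instance[of "[EqZ vx, EqZ vy]" "EqZ (vx + vy)" x y 0] that
    by (auto simp: A0_def nulls_def valuation_def terms.zero_mem terms.add_mem)
  show "a * x \<in> nulls" if "a \<in> A" "x \<in> nulls" for a x
    using closed_instance[of "[EqZ vx]" "EqZ (va * vx)" x 0 a] that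
    by (auto simp: A0_def nulls_def valuation_def terms.zero_mem terms.mult_mem)
qed

lemma nulls_ideals:
  assumes "i \<in> {1..3}"
  shows "nulls \<subseteq> ideals i"
proof
  fix x assume "x \<in> nulls"
  then show "x \<in> ideals i"
    using closed_instance[of "[EqZ vx]" "Ide i vx" x 0 0] assms
    by (auto simp: A1_def nulls_def ideals_def valuation_def terms.zero_mem)
qed

lemma ideal_ideals:
  assumes i: "i \<in> {1..3}"
  shows "terms.ideal G (ideals i)"
  unfolding terms.ideal_def
proof (intro conjI ballI)
  show "ideals i \<subseteq> A" by (auto simp: ideals_def)
  show "0 \<in> ideals i"
    using nulls_ideals[OF i] terms.ideal_zero[OF ideal_nulls] by blast
  show "x + y \<in> ideals i" if "x \<in> ideals i" "y \<in> ideals i" for x y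
    using closed_instance[of "[Ide i vx, Ide i vy]" "Ide i (vx + vy)" x y 0] that i
    by (auto simp: A1_def ideals_def valuation_def terms.zero_mem terms.add_mem)
  show "a * x \<in> ideals i" if "a \<in> A" "x \<in> ideals i" for a x
    using closed_instance[of "[Ide i vx]" "Ide i (va * vx)" x 0 a] that i
    by (auto simp: A1_def ideals_def valuation_def terms.zero_mem terms.mult_mem)
qed

lemma ideals_one:
  assumes "i \<in> {1..3}" "1 \<in> ideals i"
  shows "Falsum \<in> C"
  using closed_instance[of "[Ide i 1]" "Falsum" 0 0 0] assms
  by (auto simp: A1_def ideals_def terms.zero_mem)

lemma ideals_mono:
  assumes "i \<in> {1..2}"
  shows "ideals i \<subseteq> ideals (i + 1)"
proof
  fix x assume "x \<in> ideals i"
  then show "x \<in> ideals (i + 1)"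
    using closed_instance[of "[Ide i vx]" "Ide (i + 1) vx" x 0 0] assms
    by (auto simp: A1_def ideals_def valuation_def terms.zero_mem)
qed

lemma ideals_12: "ideals 1 \<subseteq> ideals 2" and ideals_23: "ideals 2 \<subseteq> ideals 3"
  using ideals_mono[of 1] ideals_mono[of 2] by (auto simp: numeral_eq_Suc)

lemma submonoid_monoids:
  assumes i: "i \<in> {1..3}"
  shows "terms.submonoid G (monoids i)"
  unfolding terms.submonoid_def
proof (intro conjI ballI)
  show "monoids i \<subseteq> A" by (auto simp: monoids_def)
  show "1 \<in> monoids i"
    using closed_instance[of "[]" "Ndz i 1" 0 0 0] terms.zero_mem i
    by (auto simp: A1_def monoids_def terms.one_mem)
  show "x * y \<in> monoids i" if "x \<in> monoids i" "y \<in> monoids i" for x y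
    using closed_instance[of "[Ndz i vx, Ndz i vy]" "Ndz i (vx * vy)" x y 0] that i
    by (auto simp: A1_def monoids_def valuation_def terms.zero_mem terms.mult_mem)
qed

text \<open>
  The ideals \<open>I\<close> and monoids \<open>M\<close> may be larger than those given by \<open>C\<close>, so that the model can be made
  to refute a chosen fact outside \<open>C\<close>.
\<close>

lemma exists_model:
  assumes R: "R \<subseteq> C" "R \<subseteq> facts G" and consistent: "Falsum \<notin> C"
    and I: "\<And>i. i \<in> {1..3} \<Longrightarrow> terms.ideal G (I i) \<and> ideals i \<subseteq> I i"
    and M: "\<And>i. i \<in> {1..3} \<Longrightarrow> terms.submonoid G (M i) \<and> monoids i \<subseteq> M i"
    and cert: "\<not> terms.collapse_certificate I M"
  shows "\<exists>P. is_model G nulls P \<and> R \<subseteq> model_facts G nulls P \<and>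
             (\<forall>i\<in>{1..3}. I i \<subseteq> P i \<and> P i \<inter> M i = {})"
proof -
  obtain P where P: "terms.prime_chain G P" "\<forall>i\<in>{1..3}. I i \<subseteq> P i \<and> P i \<inter> M i = {}"
    using terms.exists_prime_chain[OF _ _ cert] I M by metis
  have "nulls \<subseteq> P 1" using nulls_ideals[of 1] I[of 1] P(2) by fastforce
  then have "is_model G nulls P" using P ideal_nulls by (simp add: is_model_def)
  moreover have "R \<subseteq> model_facts G nulls P"
  proof
    fix \<phi> assume \<phi>: "\<phi> \<in> R"
    show "\<phi> \<in> model_facts G nulls P"
    proof (cases \<phi>)
      case Falsum
      then show ?thesis using \<phi> R consistent by blast
    next
      case (EqZ x)
      then show ?thesis using \<phi> R by (auto simp: nulls_def facts_def)
    next
      case (Ide i x)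
      then have "i \<in> {1..3}" "x \<in> ideals i" using \<phi> R by (auto simp: ideals_def facts_def)
      moreover from this have "ideals i \<subseteq> I i" "I i \<subseteq> P i" using I P(2) by simp_all
      ultimately show ?thesis using Ide by auto
    next
      case (Ndz i x)
      then have "i \<in> {1..3}" "x \<in> monoids i" using \<phi> R by (auto simp: monoids_def facts_def)
      moreover from this have "monoids i \<subseteq> M i" "P i \<inter> M i = {}" using M P(2) by simp_all
      moreover have "x \<in> A" using \<open>x \<in> monoids i\<close> by (simp add: monoids_def)
      ultimately show ?thesis using Ndz by auto
    qed
  qed
  ultimately show ?thesis using P(2) by blast
qed

lemma exists_model_of_closed_set:
  assumes "R \<subseteq> C" "R \<subseteq> facts G" "Falsum \<notin> C"
    and "\<not> terms.collapse_certificate ideals monoids"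
  shows "\<exists>P. is_model G nulls P \<and> R \<subseteq> model_facts G nulls P"
proof -
  have "\<exists>P. is_model G nulls P \<and> R \<subseteq> model_facts G nulls P \<and>
            (\<forall>i\<in>{1..3}. ideals i \<subseteq> P i \<and> P i \<inter> monoids i = {})"
    by (rule exists_model[OF assms(1-3) _ _ assms(4)])
       (simp_all add: ideal_ideals submonoid_monoids)
  then show ?thesis by blast
qed

lemma add_cancel:
  assumes "i \<in> {1..3}" "x + j \<in> ideals i" "j \<in> ideals i"
  shows "x \<in> ideals i"
  using terms.ideal_add[OF ideal_ideals assms(2) terms.ideal_uminus[OF ideal_ideals assms(3)]] assms(1)
  by simp

end

locale closed_dir = closed_facts +
  assumes closed_A2: "closed_under A2 G C"
begin

lemma monoids_zero:
  assumes "i \<in> {1..3}" "0 \<in> monoids i"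
  shows "Falsum \<in> C"
  using closed_underD[OF closed_A2, of "[Ndz i 0]" "Falsum" 0 0 0] assms
  by (auto simp: A2_def monoids_def terms.zero_mem)

lemma monoids_add:
  assumes "i \<in> {1..3}" "u \<in> monoids i" "j \<in> ideals i"
  shows "u + j \<in> monoids i"
  using closed_underD[OF closed_A2, of "[Ide i vx, Ndz i vy]" "Ndz i (vx + vy)" j u 0] assms
  by (auto simp: A2_def monoids_def ideals_def valuation_def terms.zero_mem terms.add_mem
      add.commute)

lemma monoids_mono:
  assumes "i \<in> {1..2}"
  shows "monoids (i + 1) \<subseteq> monoids i"
proof
  fix x assume "x \<in> monoids (i + 1)"
  then show "x \<in> monoids i"
    using closed_underD[OF closed_A2, of "[Ndz (i + 1) vx]" "Ndz i vx" x 0 0] assms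
    by (auto simp: A2_def monoids_def valuation_def terms.zero_mem)
qed

lemma monoids_21: "monoids 2 \<subseteq> monoids 1" and monoids_32: "monoids 3 \<subseteq> monoids 2"
  using monoids_mono[of 1] monoids_mono[of 2] by (auto simp: numeral_eq_Suc)

text \<open>
  With \<open>A2\<close>, adding \<open>j\<^sub>i\<close> does not lead out of the monoid of level \<open>i\<close>, and this monoid is contained in
  the monoid of the level below. So a certificate can be evaluated from the inside out.
\<close>

lemma nested_2:
  assumes "u\<^sub>2 \<in> monoids 2" "u\<^sub>3 \<in> monoids 3" "j\<^sub>3 \<in> ideals 3"
  shows "u\<^sub>2 * (u\<^sub>3 + j\<^sub>3) \<in> monoids 2"
proof -
  have "u\<^sub>3 + j\<^sub>3 \<in> monoids 2" using assms monoids_32 monoids_add[of 3] by auto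
  then show ?thesis using assms terms.submonoid_mult[OF submonoid_monoids] by auto
qed

lemma nested_1:
  assumes "u\<^sub>1 \<in> monoids 1" "u\<^sub>2 \<in> monoids 2" "u\<^sub>3 \<in> monoids 3" "j\<^sub>2 \<in> ideals 2" "j\<^sub>3 \<in> ideals 3"
  shows "u\<^sub>1 * (u\<^sub>2 * (u\<^sub>3 + j\<^sub>3) + j\<^sub>2) \<in> monoids 1"
proof -
  have "u\<^sub>2 * (u\<^sub>3 + j\<^sub>3) + j\<^sub>2 \<in> monoids 1"
    using nested_2[OF assms(2,3,5)] monoids_21 monoids_add[of 2] assms by auto
  then show ?thesis using assms terms.submonoid_mult[OF submonoid_monoids] by auto
qed

lemma dir_no_certificate:
  assumes "Falsum \<notin> C"
  shows "\<not> terms.collapse_certificate ideals monoids"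
proof
  assume "terms.collapse_certificate ideals monoids"
  then obtain u\<^sub>1 u\<^sub>2 u\<^sub>3 j\<^sub>1 j\<^sub>2 j\<^sub>3 where
    *: "u\<^sub>1 \<in> monoids 1" "u\<^sub>2 \<in> monoids 2" "u\<^sub>3 \<in> monoids 3"
      "j\<^sub>1 \<in> ideals 1" "j\<^sub>2 \<in> ideals 2" "j\<^sub>3 \<in> ideals 3"
    and 0: "u\<^sub>1 * (u\<^sub>2 * (u\<^sub>3 + j\<^sub>3) + j\<^sub>2) + j\<^sub>1 = 0"
    unfolding terms.collapse_certificate_def by blast
  have "0 \<in> monoids 1"
    using monoids_add[of 1, OF _ nested_1[OF *(1-3,5,6)] *(4)] 0 by simp
  then show False using monoids_zero[of 1] assms by simp
qed

end

locale closed_sim2 = closed_facts +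
  assumes closed_A3: "closed_under A3 G C"
begin

lemma ideals_cancel:
  assumes "i \<in> {1..3}" "u * x \<in> ideals i" "u \<in> monoids i" "x \<in> A"
  shows "x \<in> ideals i"
  using closed_underD[OF closed_A3, of "[Ide i (vx * vy), Ndz i vy]" "Ide i vx" x u 0] assms
  by (auto simp: A3_def monoids_def ideals_def valuation_def terms.zero_mem mult.commute)

text \<open>
  One step of reading a certificate from the outside in.
\<close>

lemma peel:
  assumes "i \<in> {1..3}" "u \<in> monoids i" "s \<in> A" "j \<in> ideals i" "u * s + j \<in> ideals i"
  shows "s \<in> ideals i"
  using ideals_cancel[of i u s] add_cancel[of i "u * s" j] assms by blast

lemma peel_zero:
  assumes "i \<in> {1..3}" "u \<in> monoids i" "s \<in> A" "j \<in> ideals i" "u * s + j = 0"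
  shows "s \<in> ideals i"
  using peel[OF assms(1-4)] assms(5) terms.ideal_zero[OF ideal_ideals[OF assms(1)]] by simp

lemma sim2_no_certificate:
  assumes "Falsum \<notin> C"
  shows "\<not> terms.collapse_certificate ideals monoids"
proof
  assume "terms.collapse_certificate ideals monoids"
  then obtain u\<^sub>1 u\<^sub>2 u\<^sub>3 j\<^sub>1 j\<^sub>2 j\<^sub>3 where
    *: "u\<^sub>1 \<in> monoids 1" "u\<^sub>2 \<in> monoids 2" "u\<^sub>3 \<in> monoids 3"
      "j\<^sub>1 \<in> ideals 1" "j\<^sub>2 \<in> ideals 2" "j\<^sub>3 \<in> ideals 3"
    and 0: "u\<^sub>1 * (u\<^sub>2 * (u\<^sub>3 + j\<^sub>3) + j\<^sub>2) + j\<^sub>1 = 0"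
    unfolding terms.collapse_certificate_def by blast
  have A: "u\<^sub>2 \<in> A" "u\<^sub>3 \<in> A" "j\<^sub>2 \<in> A" "j\<^sub>3 \<in> A" using * by (auto simp: monoids_def ideals_def)
  have "u\<^sub>2 * (u\<^sub>3 + j\<^sub>3) + j\<^sub>2 \<in> ideals 1"
    using peel_zero[of 1 u\<^sub>1 _ j\<^sub>1] * A 0 by (simp add: terms.add_mem terms.mult_mem)
  then have "u\<^sub>3 + j\<^sub>3 \<in> ideals 2"
    using peel[of 2 u\<^sub>2 "u\<^sub>3 + j\<^sub>3" j\<^sub>2] * A ideals_12 by (auto simp: terms.add_mem)
  then have "1 \<in> ideals 3"
    using peel[of 3 u\<^sub>3 1 j\<^sub>3] * ideals_23 by (auto simp: terms.one_mem)
  then show False using ideals_one[of 3] assms by simp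
qed

end

locale closed_sim1 = closed_dir + closed_sim2 +
  assumes closed_A4: "closed_under A4 G C"
begin

lemma monoids_factor:
  assumes "i \<in> {1..3}" "a * x \<in> monoids i" "a \<in> A" "x \<in> A"
  shows "x \<in> monoids i"
proof -
  have *: "\<forall>v. valuation a x 0 v \<in> A" using assms by (simp add: valuation_def terms.zero_mem)
  have ax: "([Ndz i (vx * vy)] \<turnstile> [[Ndz i vx, Ndz i vy]]) \<in> A4" using assms by (auto simp: A4_def)
  show ?thesis
    using closed_A4[unfolded closed_under_def, rule_format, OF ax, of "valuation a x 0"] * assms
    by (auto simp: monoids_def valuation_def)
qed

lemma ideals_square:
  assumes "i \<in> {1..3}" "x\<^sup>2 \<in> ideals i" "x \<in> A"
  shows "x \<in> ideals i"
  using closed_underD[OF closed_A4, of "[Ide i (vx ^ 2)]" "Ide i vx" x 0 0] assms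
  by (auto simp: A4_def ideals_def valuation_def terms.zero_mem)

lemma ideals_radical:
  assumes i: "i \<in> {1..3}" and x: "x \<in> A" and consistent: "Falsum \<notin> C" and xn: "x ^ n \<in> ideals i"
  shows "x \<in> ideals i"
  using xn
proof (induction n rule: less_induct)
  case (less n)
  consider "n = 0" | "n = 1" | "n \<ge> 2" by linarith
  then show ?case
  proof cases
    case 1
    then show ?thesis using less.prems ideals_one[OF i] consistent by simp
  next
    case 2
    then show ?thesis using less.prems by simp
  next
    case 3
    \<comment> \<open>the least \<open>k\<close> with \<open>n \<le> 2 k\<close>, so that \<open>x\<^sup>n\<close> divides the square of \<open>x\<^sup>k\<close>\<close>
    define k where "k = (n + 1) div 2"
    have k: "k < n" "n \<le> k * 2" using 3 unfolding k_def by linarith+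
    have "(x ^ k)\<^sup>2 = x ^ (k * 2 - n) * x ^ n"
      using k by (simp add: power_mult[symmetric] power_add[symmetric])
    also have "\<dots> \<in> ideals i"
      using terms.ideal_mult[OF ideal_ideals[OF i]] terms.power_mem[OF x] less.prems by blast
    finally have "x ^ k \<in> ideals i" using ideals_square[OF i] terms.power_mem[OF x] by blast
    then show ?thesis using less.IH[OF k(1)] by blast
  qed
qed

definition adjoin_powers :: "'g ring_term \<Rightarrow> 'g ring_term set \<Rightarrow> 'g ring_term set" where
  "adjoin_powers x M = {u * x ^ n | u n. u \<in> M}"

lemma submonoid_adjoin_powers:
  assumes M: "terms.submonoid G M" and x: "x \<in> A"
  shows "terms.submonoid G (adjoin_powers x M)"
  unfolding terms.submonoid_def
proof (intro conjI ballI)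
  show "adjoin_powers x M \<subseteq> A"
    using terms.submonoid_subset[OF M] x
    by (auto simp: adjoin_powers_def intro!: terms.mult_mem terms.power_mem)
  have "1 * x ^ 0 \<in> adjoin_powers x M"
    unfolding adjoin_powers_def using terms.submonoid_one[OF M] by blast
  then show "1 \<in> adjoin_powers x M" by simp
next
  fix y z assume "y \<in> adjoin_powers x M" "z \<in> adjoin_powers x M"
  then obtain u n v m where "u \<in> M" "v \<in> M" "y = u * x ^ n" "z = v * x ^ m"
    by (auto simp: adjoin_powers_def)
  moreover have "(u * x ^ n) * (v * x ^ m) = (u * v) * x ^ (n + m)"
    by (simp add: power_add ac_simps)
  ultimately show "y * z \<in> adjoin_powers x M"
    unfolding adjoin_powers_def using terms.submonoid_mult[OF M] by blast
qed

lemma adjoin_powers_superset: "M \<subseteq> adjoin_powers x M"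
proof
  fix u assume "u \<in> M"
  then have "u * x ^ 0 \<in> adjoin_powers x M" unfolding adjoin_powers_def by blast
  then show "u \<in> adjoin_powers x M" by simp
qed

lemma mem_adjoin_powers:
  assumes "1 \<in> M"
  shows "x \<in> adjoin_powers x M"
proof -
  have "1 * x ^ 1 \<in> adjoin_powers x M" unfolding adjoin_powers_def using assms by blast
  then show ?thesis by simp
qed

text \<open>
  In a certificate in which the factor of level \<open>i\<close> is \<open>v x\<^sup>n\<close>, the outer levels are removed by
  cancellation and the inner levels are absorbed in a monoid. What remains is \<open>x\<^sup>n \<in> I\<^sub>i\<close>, hence
  \<open>x \<in> I\<^sub>i\<close>.
\<close>

lemma no_certificate_adjoin_powers:
  assumes i: "i \<in> {1..3}" and x: "x \<in> A" "x \<notin> ideals i" and consistent: "Falsum \<notin> C"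
  shows "\<not> terms.collapse_certificate ideals (monoids(i := adjoin_powers x (monoids i)))"
    (is "\<not> terms.collapse_certificate ideals ?N")
proof
  assume "terms.collapse_certificate ideals ?N"
  then obtain u\<^sub>1 u\<^sub>2 u\<^sub>3 j\<^sub>1 j\<^sub>2 j\<^sub>3 where
    u: "u\<^sub>1 \<in> ?N 1" "u\<^sub>2 \<in> ?N 2" "u\<^sub>3 \<in> ?N 3"
    and j: "j\<^sub>1 \<in> ideals 1" "j\<^sub>2 \<in> ideals 2" "j\<^sub>3 \<in> ideals 3"
    and 0: "u\<^sub>1 * (u\<^sub>2 * (u\<^sub>3 + j\<^sub>3) + j\<^sub>2) + j\<^sub>1 = 0"
    unfolding terms.collapse_certificate_def by blast
  have "terms.submonoid G (?N k)" if "k \<in> {1..3}" for k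
    using that submonoid_adjoin_powers[OF submonoid_monoids x(1)] submonoid_monoids by simp
  then have "?N k \<subseteq> A" if "k \<in> {1..3}" for k
    using that terms.submonoid_subset by blast
  from this[of 1] this[of 2] this[of 3] have uA: "u\<^sub>1 \<in> A" "u\<^sub>2 \<in> A" "u\<^sub>3 \<in> A"
    using u by (simp_all add: subset_iff del: fun_upd_apply)
  have jA: "j\<^sub>1 \<in> A" "j\<^sub>2 \<in> A" "j\<^sub>3 \<in> A" using j by (auto simp: ideals_def)
  note mem = terms.add_mem terms.mult_mem terms.power_mem uA jA x(1)
  have inner: "u\<^sub>2 * (u\<^sub>3 + j\<^sub>3) + j\<^sub>2 \<in> A"
    by (intro terms.add_mem terms.mult_mem uA jA)
  have zero: "0 \<in> ideals k" if "k \<in> {1..3}" for k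
    using that terms.ideal_zero[OF ideal_ideals] by blast
  consider "i = 1" | "i = 2" | "i = 3" using i by fastforce
  then have "\<exists>n. x ^ n \<in> ideals i"
  proof cases
    case 1
    then obtain v n where v: "v \<in> monoids 1" "u\<^sub>1 = v * x ^ n"
      using u by (auto simp: adjoin_powers_def)
    have "v * (u\<^sub>2 * (u\<^sub>3 + j\<^sub>3) + j\<^sub>2) \<in> monoids 1" using 1 u j v nested_1 by simp
    moreover have "(v * (u\<^sub>2 * (u\<^sub>3 + j\<^sub>3) + j\<^sub>2)) * x ^ n + j\<^sub>1 \<in> ideals 1"
      using 0 v zero[of 1] by (simp add: ac_simps)
    ultimately have "x ^ n \<in> ideals 1" using j mem by (intro peel[of 1 _ "x ^ n" j\<^sub>1]) auto
    then show ?thesis using 1 by blast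
  next
    case 2
    then obtain v n where v: "v \<in> monoids 2" "u\<^sub>2 = v * x ^ n"
      using u by (auto simp: adjoin_powers_def)
    have "u\<^sub>2 * (u\<^sub>3 + j\<^sub>3) + j\<^sub>2 \<in> ideals 1"
      using peel_zero[OF _ _ inner j(1) 0] u 2 by simp
    then have "(v * (u\<^sub>3 + j\<^sub>3)) * x ^ n + j\<^sub>2 \<in> ideals 2"
      using ideals_12 v by (auto simp: ac_simps)
    moreover have "v * (u\<^sub>3 + j\<^sub>3) \<in> monoids 2" using 2 u j v nested_2 by simp
    ultimately have "x ^ n \<in> ideals 2" using j mem by (intro peel[of 2 _ "x ^ n" j\<^sub>2]) auto
    then show ?thesis using 2 by blast
  next
    case 3
    then obtain v n where v: "v \<in> monoids 3" "u\<^sub>3 = v * x ^ n"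
      using u by (auto simp: adjoin_powers_def)
    have "u\<^sub>2 * (u\<^sub>3 + j\<^sub>3) + j\<^sub>2 \<in> ideals 1"
      using peel_zero[OF _ _ inner j(1) 0] u 3 by simp
    then have "u\<^sub>3 + j\<^sub>3 \<in> ideals 2"
      using peel[of 2 u\<^sub>2 "u\<^sub>3 + j\<^sub>3" j\<^sub>2] terms.add_mem[OF uA(3) jA(3)] u j 3 ideals_12 by auto
    then have "x ^ n \<in> ideals 3" using peel[of 3 v "x ^ n" j\<^sub>3] terms.power_mem[OF x(1)] ideals_23 v j by auto
    then show ?thesis using 3 by blast
  qed
  then show False using ideals_radical[OF i x(1) consistent] x(2) by blast
qed

lemma monoids_of_relation:
  assumes i: "i \<in> {1..3}" and v: "v \<in> monoids i" and a: "a \<in> A" and x: "x \<in> A"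
    and rel: "v + a * x \<in> ideals i"
  shows "x \<in> monoids i"
proof -
  have "v + - (v + a * x) \<in> monoids i"
    using monoids_add[OF i v] terms.ideal_uminus[OF ideal_ideals[OF i] rel] by blast
  then have "(- a) * x \<in> monoids i" by simp
  then show ?thesis using monoids_factor[OF i] terms.uminus_mem a x by blast
qed

text \<open>
  Here the summand of level \<open>i\<close> is \<open>j + a x\<close>. Removing the outer levels and absorbing the inner ones
  leaves \<open>v + a x \<in> I\<^sub>i\<close> with \<open>v \<in> M\<^sub>i\<close>, so that \<open>- a x\<close>, and by saturation \<open>x\<close>, is in \<open>M\<^sub>i\<close>.
\<close>

lemma no_certificate_adjoin_element:
  assumes i: "i \<in> {1..3}" and x: "x \<in> A" "x \<notin> monoids i"
  shows "\<not> terms.collapse_certificate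
            (ideals(i := terms.ideal_sum (ideals i) (terms.principal G x))) monoids"
    (is "\<not> terms.collapse_certificate ?J monoids")
proof
  assume "terms.collapse_certificate ?J monoids"
  then obtain u\<^sub>1 u\<^sub>2 u\<^sub>3 j\<^sub>1 j\<^sub>2 j\<^sub>3 where
    u: "u\<^sub>1 \<in> monoids 1" "u\<^sub>2 \<in> monoids 2" "u\<^sub>3 \<in> monoids 3"
    and j: "j\<^sub>1 \<in> ?J 1" "j\<^sub>2 \<in> ?J 2" "j\<^sub>3 \<in> ?J 3"
    and 0: "u\<^sub>1 * (u\<^sub>2 * (u\<^sub>3 + j\<^sub>3) + j\<^sub>2) + j\<^sub>1 = 0"
    unfolding terms.collapse_certificate_def by blast
  have "terms.ideal G (?J k)" if "k \<in> {1..3}" for k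
    using that terms.ideal_ideal_sum[OF ideal_ideals terms.ideal_principal[OF x(1)]] ideal_ideals
    by simp
  then have "?J k \<subseteq> A" if "k \<in> {1..3}" for k
    using that terms.ideal_subset by blast
  from this[of 1] this[of 2] this[of 3] have jA: "j\<^sub>1 \<in> A" "j\<^sub>2 \<in> A" "j\<^sub>3 \<in> A"
    using j by (simp_all add: subset_iff del: fun_upd_apply)
  have uA: "u\<^sub>1 \<in> A" "u\<^sub>2 \<in> A" "u\<^sub>3 \<in> A" using u by (auto simp: monoids_def)
  have inner: "u\<^sub>2 * (u\<^sub>3 + j\<^sub>3) + j\<^sub>2 \<in> A"
    by (intro terms.add_mem terms.mult_mem uA jA)
  have zero: "0 \<in> ideals 1" using terms.ideal_zero[OF ideal_ideals] by simp
  consider "i = 1" | "i = 2" | "i = 3" using i by fastforce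
  then have "x \<in> monoids i"
  proof cases
    case 1
    then obtain j a where ja: "j \<in> ideals 1" "a \<in> A" "j\<^sub>1 = j + a * x"
      using j by (auto simp: terms.ideal_sum_def terms.principal_def)
    have "u\<^sub>1 * (u\<^sub>2 * (u\<^sub>3 + j\<^sub>3) + j\<^sub>2) + j \<in> monoids 1"
      using 1 u j ja nested_1 monoids_add[of 1] by simp
    moreover have "(u\<^sub>1 * (u\<^sub>2 * (u\<^sub>3 + j\<^sub>3) + j\<^sub>2) + j) + a * x \<in> ideals 1"
      using 0 ja zero by (simp add: add.assoc)
    ultimately show ?thesis using monoids_of_relation[OF i] 1 ja x by blast
  next
    case 2
    then obtain j a where ja: "j \<in> ideals 2" "a \<in> A" "j\<^sub>2 = j + a * x"
      using j by (auto simp: terms.ideal_sum_def terms.principal_def)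
    have "u\<^sub>2 * (u\<^sub>3 + j\<^sub>3) + j\<^sub>2 \<in> ideals 1"
      using peel_zero[OF _ u(1) inner _ 0] j 2 by simp
    then have "(u\<^sub>2 * (u\<^sub>3 + j\<^sub>3) + j) + a * x \<in> ideals 2"
      using ideals_12 ja by (auto simp: add.assoc)
    moreover have "u\<^sub>2 * (u\<^sub>3 + j\<^sub>3) + j \<in> monoids 2"
      using 2 u j ja nested_2 monoids_add[of 2] by simp
    ultimately show ?thesis using monoids_of_relation[OF i] 2 ja x by blast
  next
    case 3
    then obtain j a where ja: "j \<in> ideals 3" "a \<in> A" "j\<^sub>3 = j + a * x"
      using j by (auto simp: terms.ideal_sum_def terms.principal_def)
    have "u\<^sub>2 * (u\<^sub>3 + j\<^sub>3) + j\<^sub>2 \<in> ideals 1"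
      using peel_zero[OF _ u(1) inner _ 0] j 3 by simp
    then have "u\<^sub>3 + j\<^sub>3 \<in> ideals 2"
      using peel[of 2 u\<^sub>2 "u\<^sub>3 + j\<^sub>3" j\<^sub>2] terms.add_mem[OF uA(3) jA(3)] u j 3 ideals_12 by auto
    then have "(u\<^sub>3 + j) + a * x \<in> ideals 3" using ideals_23 ja by (auto simp: add.assoc)
    moreover have "u\<^sub>3 + j \<in> monoids 3" using u ja monoids_add[of 3] by simp
    ultimately show ?thesis using monoids_of_relation[OF i] 3 ja x by blast
  qed
  then show False using x by blast
qed

end


section \<open>Completeness\<close>

definition has_countermodel :: "'g set \<Rightarrow> 'g ring_term atom set \<Rightarrow> 'g ring_term atom \<Rightarrow> bool" where
  "has_countermodel G R \<phi> \<longleftrightarrow>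
     (\<exists>Z P. is_model G Z P \<and> R \<subseteq> model_facts G Z P \<and> \<phi> \<notin> model_facts G Z P)"

lemmas theory_defs = P3_dir_def P3_dyn1_def P3_sim1_def P3_sim2_def

lemma theories_subset:
  "P3_dir \<subseteq> P3_dyn1" "P3_dir \<subseteq> P3_sim1" "P3_sim2 \<subseteq> P3_sim1"
  "P3_dir \<subseteq> all_axioms" "P3_dyn1 \<subseteq> all_axioms" "P3_sim1 \<subseteq> all_axioms" "P3_sim2 \<subseteq> all_axioms"
  by (auto simp: theory_defs all_axioms_def)

lemma no_countermodel:
  assumes "derives T G R \<phi>" "T \<subseteq> all_axioms"
  shows "\<not> has_countermodel G R \<phi>"
  using derives_sound[OF assms] by (auto simp: has_countermodel_def)

lemma closed_facts_derives:
  assumes "Ax_False \<union> A0 \<union> A1 \<subseteq> T"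
  shows "closed_facts G {\<phi>. derives T G R \<phi>}"
  by unfold_locales (rule closed_under_derives[OF assms])

lemma derives_of_Falsum:
  assumes "Ax_False \<union> A0 \<union> A1 \<subseteq> T" "derives T G R Falsum" "\<phi> \<in> facts G"
  shows "derives T G R \<phi>"
proof -
  interpret closed_facts G "{\<phi>. derives T G R \<phi>}" by (rule closed_facts_derives[OF assms(1)])
  show ?thesis using Falsum_all assms(2,3) by blast
qed

text \<open>
  Equations are interpreted as restrictively as possible, by the derivable ones, so that this model
  also refutes every equation that is not derivable.
\<close>

lemma dir_model:
  assumes R: "R \<subseteq> facts G" and consistent: "\<not> derives P3_dir G R Falsum"
  shows "\<exists>P. is_model G {x \<in> closed_terms G. derives P3_dir G R (EqZ x)} P \<and>
             R \<subseteq> model_facts G {x \<in> closed_terms G. derives P3_dir G R (EqZ x)} P"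
proof -
  let ?C = "{\<phi>. derives P3_dir G R \<phi>}"
  interpret closed_dir G ?C
    by unfold_locales (rule closed_under_derives, auto simp: P3_dir_def)+
  have nulls_eq: "nulls = {x \<in> A. derives P3_dir G R (EqZ x)}" by (simp add: nulls_def)
  have "R \<subseteq> ?C" by (auto intro: derives.hyp)
  moreover have "Falsum \<notin> ?C" using consistent by simp
  ultimately show ?thesis
    unfolding nulls_eq[symmetric] using R by (intro exists_model_of_closed_set dir_no_certificate)
qed

lemma sim2_model:
  assumes R: "R \<subseteq> facts G" and consistent: "\<not> derives P3_sim2 G R Falsum"
  shows "has_countermodel G R Falsum"
proof -
  let ?C = "{\<phi>. derives P3_sim2 G R \<phi>}"
  interpret closed_sim2 G ?C
    by unfold_locales (rule closed_under_derives, auto simp: P3_sim2_def)+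
  have "R \<subseteq> ?C" by (auto intro: derives.hyp)
  moreover have "Falsum \<notin> ?C" using consistent by simp
  ultimately have "\<exists>P. is_model G nulls P \<and> R \<subseteq> model_facts G nulls P"
    using R by (intro exists_model_of_closed_set sim2_no_certificate)
  then show ?thesis unfolding has_countermodel_def by auto
qed

lemma collapse_iff_no_model:
  assumes "T \<in> {P3_dir, P3_dyn1, P3_sim1, P3_sim2}" "R \<subseteq> facts G"
  shows "derives T G R Falsum \<longleftrightarrow> \<not> has_countermodel G R Falsum"
proof
  assume "derives T G R Falsum"
  then show "\<not> has_countermodel G R Falsum"
    using no_countermodel assms theories_subset by blast
next
  assume "\<not> has_countermodel G R Falsum"
  then have "derives P3_dir G R Falsum" "derives P3_sim2 G R Falsum"
    using dir_model[OF assms(2)] sim2_model[OF assms(2)]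
    by (auto simp: has_countermodel_def)
  then show "derives T G R Falsum"
    using derives_mono[of P3_dir G R Falsum R T] assms(1) theories_subset by auto
qed

text \<open>
  By \<open>A5\<close>, if \<open>Ide i x\<close> is not derivable, then adding \<open>Ndz i x\<close> does not lead to a collapse; a
  model of the enlarged presentation refutes \<open>Ide i x\<close>. The same holds with the roles exchanged. For an
  equation, the model with the fewest equations serves.
\<close>

lemma dyn1_complete:
  assumes R: "R \<subseteq> facts G" and \<phi>: "\<phi> \<in> facts G" and nd: "\<not> derives P3_dyn1 G R \<phi>"
  shows "has_countermodel G R \<phi>"
proof -
  have base: "Ax_False \<union> A0 \<union> A1 \<subseteq> P3_dyn1" by (auto simp: P3_dyn1_def)
  have explode: "derives P3_dyn1 G S \<phi>" if "derives P3_dir G S Falsum" for S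
    using derives_of_Falsum[OF base _ \<phi>] derives_mono[OF that order_refl theories_subset(1)] .
  have split: "derives P3_dyn1 G R \<phi>"
    if "i \<in> {1..3}" "x \<in> closed_terms G" "derives P3_dyn1 G (insert (Ide i x) R) \<phi>"
      "derives P3_dyn1 G (insert (Ndz i x) R) \<phi>" for i x
    by (rule derives.rule[of "[]" "[[Ide i vx], [Ndz i vx]]" _ "\<lambda>_. x"])
       (use that in \<open>auto simp: P3_dyn1_def A5_def\<close>)
  have model: "\<exists>Z P. is_model G Z P \<and> S \<subseteq> model_facts G Z P"
    if "S \<subseteq> facts G" "\<not> derives P3_dyn1 G S \<phi>" for S
    using dir_model[OF that(1)] explode that(2) by blast
  show ?thesis
  proof (cases \<phi>)
    case Falsum
    then show ?thesis using model[OF R nd] by (auto simp: has_countermodel_def)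
  next
    case (EqZ x)
    have "\<not> derives P3_dir G R (EqZ x)"
      using nd EqZ derives_mono[OF _ order_refl theories_subset(1)] by blast
    then show ?thesis
      using dir_model[OF R] explode nd EqZ unfolding has_countermodel_def
      by (metis (no_types, lifting) mem_Collect_eq model_facts_iff(2))
  next
    case (Ide i x)
    then have i: "i \<in> {1..3}" "x \<in> closed_terms G" using \<phi> by (auto simp: facts_def)
    have "\<not> derives P3_dyn1 G (insert (Ndz i x) R) \<phi>"
      using split[OF i] nd Ide by (auto intro: derives.hyp)
    moreover have "insert (Ndz i x) R \<subseteq> facts G" using R i by (auto simp: facts_def)
    ultimately obtain Z P where "is_model G Z P" "insert (Ndz i x) R \<subseteq> model_facts G Z P"
      using model by blast
    then show ?thesis using Ide unfolding has_countermodel_def by (auto intro!: exI[of _ Z] exI[of _ P])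
  next
    case (Ndz i x)
    then have i: "i \<in> {1..3}" "x \<in> closed_terms G" using \<phi> by (auto simp: facts_def)
    have "\<not> derives P3_dyn1 G (insert (Ide i x) R) \<phi>"
      using split[OF i] nd Ndz by (auto intro: derives.hyp)
    moreover have "insert (Ide i x) R \<subseteq> facts G" using R i by (auto simp: facts_def)
    ultimately obtain Z P where "is_model G Z P" "insert (Ide i x) R \<subseteq> model_facts G Z P"
      using model by blast
    then show ?thesis using Ndz unfolding has_countermodel_def by (auto intro!: exI[of _ Z] exI[of _ P])
  qed
qed

text \<open>
  A model that refutes \<open>Ide i x\<close> is obtained by adjoining the powers of \<open>x\<close> to the monoid of level
  \<open>i\<close>, one that refutes \<open>Ndz i x\<close> by adjoining \<open>x\<close> to the ideal of level \<open>i\<close>.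
\<close>

lemma sim1_complete:
  assumes R: "R \<subseteq> facts G" and \<phi>: "\<phi> \<in> facts G" and nd: "\<not> derives P3_sim1 G R \<phi>"
  shows "has_countermodel G R \<phi>"
proof -
  let ?C = "{\<phi>. derives P3_sim1 G R \<phi>}"
  interpret closed_sim1 G ?C
    by unfold_locales (rule closed_under_derives, auto simp: P3_sim1_def)+
  have consistent: "Falsum \<notin> ?C" using Falsum_all \<phi> nd by blast
  have RC: "R \<subseteq> ?C" by (auto intro: derives.hyp)
  note model = exists_model[OF RC R consistent]
  have plain: "\<exists>P. is_model G nulls P \<and> R \<subseteq> model_facts G nulls P"
    by (rule exists_model_of_closed_set[OF RC R consistent dir_no_certificate[OF consistent]])
  show ?thesis
  proof (cases \<phi>)
    case Falsum
    then show ?thesis using plain by (auto simp: has_countermodel_def)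
  next
    case (EqZ x)
    then have "x \<notin> nulls" using nd by (simp add: nulls_def)
    then show ?thesis using plain EqZ by (auto simp: has_countermodel_def)
  next
    case (Ide i x)
    then have i: "i \<in> {1..3}" "x \<in> A" "x \<notin> ideals i"
      using \<phi> nd by (auto simp: facts_def ideals_def)
    let ?N = "monoids(i := adjoin_powers x (monoids i))"
    have "terms.submonoid G (?N k) \<and> monoids k \<subseteq> ?N k" if "k \<in> {1..3}" for k
      using that i submonoid_monoids submonoid_adjoin_powers adjoin_powers_superset[of "monoids i"]
      by auto
    then have "\<exists>P. is_model G nulls P \<and> R \<subseteq> model_facts G nulls P \<and>
              (\<forall>k\<in>{1..3}. ideals k \<subseteq> P k \<and> P k \<inter> ?N k = {})"
      using ideal_ideals no_certificate_adjoin_powers[OF i consistent] by (intro model) blast+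
    moreover have "x \<in> ?N i"
      using mem_adjoin_powers terms.submonoid_one[OF submonoid_monoids[OF i(1)]] by simp
    ultimately obtain P where "is_model G nulls P" "R \<subseteq> model_facts G nulls P" "x \<notin> P i"
      using i(1) by blast
    then show ?thesis using Ide unfolding has_countermodel_def
      by (auto intro!: exI[of _ nulls] exI[of _ P])
  next
    case (Ndz i x)
    then have i: "i \<in> {1..3}" "x \<in> A" "x \<notin> monoids i"
      using \<phi> nd by (auto simp: facts_def monoids_def)
    let ?J = "ideals(i := terms.ideal_sum (ideals i) (terms.principal G x))"
    have "terms.ideal G (?J k) \<and> ideals k \<subseteq> ?J k" if "k \<in> {1..3}" for k
      using that ideal_ideals
        terms.ideal_ideal_sum[OF ideal_ideals[OF i(1)] terms.ideal_principal[OF i(2)]]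
        terms.ideal_sum_left[OF terms.ideal_principal[OF i(2)]]
      by auto
    then have "\<exists>P. is_model G nulls P \<and> R \<subseteq> model_facts G nulls P \<and>
              (\<forall>k\<in>{1..3}. ?J k \<subseteq> P k \<and> P k \<inter> monoids k = {})"
      using submonoid_monoids no_certificate_adjoin_element[OF i]
      by (intro model) blast+
    moreover have "x \<in> ?J i"
      using terms.ideal_sum_right[OF ideal_ideals[OF i(1)]] terms.mem_principal by auto
    ultimately obtain P where "is_model G nulls P" "R \<subseteq> model_facts G nulls P" "x \<in> P i"
      using i(1) by blast
    then show ?thesis using Ndz unfolding has_countermodel_def
      by (auto intro!: exI[of _ nulls] exI[of _ P])
  qed
qed

theorem mainTheorem4:
  "(\<forall>T \<in> {P3_dir, P3_dyn1, P3_sim1, P3_sim2}. \<forall>T' \<in> {P3_dir, P3_dyn1, P3_sim1, P3_sim2}.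
      collapse_simultaneously TYPE('g) T T') \<and>
   prove_same_facts TYPE('g) P3_dyn1 P3_sim1"
proof (intro conjI ballI)
  fix T T' assume "T \<in> {P3_dir, P3_dyn1, P3_sim1, P3_sim2}" "T' \<in> {P3_dir, P3_dyn1, P3_sim1, P3_sim2}"
  then show "collapse_simultaneously TYPE('g) T T'"
    unfolding collapse_simultaneously_def presentation_def collapses_iff_derives
    by (simp add: collapse_iff_no_model[of T] collapse_iff_no_model[of T'])
next
  have "derives P3_dyn1 G R \<phi> \<longleftrightarrow> derives P3_sim1 G R \<phi>"
    if "R \<subseteq> facts G" "\<phi> \<in> facts G" for G :: "'g set" and R \<phi>
  proof -
    have "derives P3_dyn1 G R \<phi> \<longleftrightarrow> \<not> has_countermodel G R \<phi>"
      using dyn1_complete[OF that] no_countermodel[OF _ theories_subset(5)] by metis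
    also have "\<dots> \<longleftrightarrow> derives P3_sim1 G R \<phi>"
      using sim1_complete[OF that] no_countermodel[OF _ theories_subset(6)] by metis
    finally show ?thesis .
  qed
  then show "prove_same_facts TYPE('g) P3_dyn1 P3_sim1"
    unfolding prove_same_facts_def presentation_def true_fact_iff_derives by auto
qed

end
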